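(* Assume that the known functions satisfy $f,c^0\in C^2([0,L])$, $I\in C^2([\lambda_0,\lambda_*])$, $\rho\in C^2([0,\infty))$ (with $f\ge 0$, $0\le I\le 1$, $\rho\ge 0$, $c^0>0$). Let $c$ be the solution of the photochemical model and let $\{c_j^n\}$ be its approximations computed by the predictor-corrector (PC) scheme (both described in the context) with $\Delta x=L/N_x$, $\Delta t=T/N_t$, $\Delta\lambda=(\lambda_*-\lambda_0)/N_\lambda$ and $N_x,N_t,N_\lambda\in\mathbb{N}$. Then there exists a constant $\kappa>0$ (independent of the stepsizes) such that $$\max_{0\le n\le N_t,\;0\le j\le N_x}|c(x_j,t_n)-c_j^n|\le\kappa(\Delta x+\Delta t+\Delta\lambda)^2.$$ Furthermore, the predictor-corrector method is convergent of order $2$.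
   Context: Constants: $L,T>0$, $\lambda_0<\lambda_*$, $\mu>0$, $a_1>0$, $a_2\ge 0$. The function $\rho$ is $\rho(X)=\dfrac{a_1X}{X^2+a_2X+1}$ for $X\ge 0$, $C_0(x)=\int_0^x c^0(\xi)\,d\xi$, and $$\iota(\lambda,y,s)=I(\lambda)\exp\{-\mu(\varepsilon_B(\lambda)\,y+(\varepsilon_A(\lambda)-\varepsilon_B(\lambda))\,s)\},$$ with $\varepsilon_A,\varepsilon_B:[\lambda_0,\lambda_*]\to\mathbb{R}$ given functions (molar absorption coefficients). Model: $c(x,t)$ is the solution on $[0,L]\times[0,T]$ of $$\frac{\partial c}{\partial t}(x,t)=-c(x,t)f(x)\int_{\lambda_0}^{\lambda_*}\rho\Big(\iota\Big(\lambda,C_0(x),\int_0^x c(\xi,t)\,d\xi\Big)\Big)d\lambda,\qquad c(x,0)=c^0(x).$$ Grid: $x_j=j\Delta x$, $t_n=n\Delta t$, $\lambda_l=\lambda_0+l\Delta\lambda$. PC scheme: $\varphi:(0,\infty)\to(0,\infty)$ is a function with $\varphi(\Delta t)=\Delta t+\mathcal{O}(\Delta t^2)$. Given the positive initial values $c_j^0=c^0(x_j)$, for $n\ge 1$ and $j\ge 0$, $$p_j^n=c_j^{n-1}\Big\{1+\varphi(\Delta t)\,\Delta\lambda\,f(x_j)\sum_{l=0}^{N_\lambda-1}\rho\Big(\iota\Big(\lambda_l,C_0(x_j),\Delta x\sum_{r=0}^{j-1}c_r^{n-1}\Big)\Big)\Big\}^{-1},$$ $$\beta_j^l=\rho\Big(\iota\Big(\lambda_l,C_0(x_j),\frac{\Delta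 x}{2}\Big(c_0^{n-1}+2\sum_{k=1}^{j-1}c_k^{n-1}+c_j^{n-1}\Big)\Big)\Big),$$ $$\gamma_j^l=\rho\Big(\iota\Big(\lambda_l,C_0(x_j),\frac{\Delta x}{2}\Big(p_0^{n}+2\sum_{k=1}^{j-1}p_k^{n}+p_j^{n}\Big)\Big)\Big),\qquad l=0,\dots,N_\lambda,$$ $$c_j^n=c_j^{n-1}\exp\Big\{-\frac{\Delta t}{2}\,\frac{\Delta\lambda}{2}\,f(x_j)\Big(\beta_j^0+\gamma_j^0+2\sum_{l=1}^{N_\lambda-1}(\beta_j^l+\gamma_j^l)+\beta_j^{N_\lambda}+\gamma_j^{N_\lambda}\Big)\Big\}.$$
   Formalization: The absorption coefficients ε_A, ε_B are also assumed C² on [λ_0,λ_*] (for arbitrary functions second order fails), and at j=0 the trapezoidal sums in β and γ are taken to be 0 instead of Δx·c_0 or Δx·p_0, which would give only first order at x_0. *)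

theory Defs
  imports "HOL-Analysis.Analysis" "HOL-Library.Landau_Symbols"
begin

(* C^2(S) for an interval S; derivatives are one-sided at end points belonging to S. *)
definition C2_on :: "(real \<Rightarrow> real) \<Rightarrow> real set \<Rightarrow> bool" where
  "C2_on g S \<longleftrightarrow>
     (\<exists>g' g''. (\<forall>x\<in>S. (g has_real_derivative g' x) (at x within S)) \<and>
              (\<forall>x\<in>S. (g' has_real_derivative g'' x) (at x within S)) \<and>
              continuous_on S g'')"

definition rho :: "real \<Rightarrow> real \<Rightarrow> real \<Rightarrow> real" where
  "rho a\<^sub>1 a\<^sub>2 X = a\<^sub>1 * X / (X\<^sup>2 + a\<^sub>2 * X + 1)"

definition iota ::
  "real \<Rightarrow> (real \<Rightarrow> real) \<Rightarrow> (real \<Rightarrow> real) \<Rightarrow> (real \<Rightarrow> real) \<Rightarrow> real \<Rightarrow> real \<Rightarrow> real \<Rightarrow> real" where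
  "iota \<mu> I \<epsilon>\<^sub>A \<epsilon>\<^sub>B l y s = I l * exp (- \<mu> * (\<epsilon>\<^sub>B l * y + (\<epsilon>\<^sub>A l - \<epsilon>\<^sub>B l) * s))"

definition cumulative :: "(real \<Rightarrow> real) \<Rightarrow> real \<Rightarrow> real" where
  "cumulative c\<^sub>0 x = integral {0..x} c\<^sub>0"

(* Throughout, R l y s stands for the composite rho(iota(l, y, s)). The integrability
   clause is what makes the inner integral meaningful; without it the library's
   integral would silently be 0. *)
definition photo_solution ::
  "(real \<Rightarrow> real \<Rightarrow> real \<Rightarrow> real) \<Rightarrow> (real \<Rightarrow> real) \<Rightarrow> (real \<Rightarrow> real) \<Rightarrow> real \<Rightarrow> real
   \<Rightarrow> real \<Rightarrow> real \<Rightarrow> (real \<Rightarrow> real \<Rightarrow> real) \<Rightarrow> bool" where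
  "photo_solution R f c\<^sub>0 L T lam0 lam1 c \<longleftrightarrow>
     (\<forall>t\<in>{0..T}. (\<lambda>\<xi>. c \<xi> t) integrable_on {0..L}) \<and>
     (\<forall>x\<in>{0..L}. c x 0 = c\<^sub>0 x) \<and>
     (\<forall>x\<in>{0..L}. \<forall>t\<in>{0..T}.
        ((\<lambda>\<tau>. c x \<tau>) has_real_derivative
          - c x t * f x * integral {lam0..lam1}
              (\<lambda>l. R l (cumulative c\<^sub>0 x) (integral {0..x} (\<lambda>\<xi>. c \<xi> t))))
        (at t within {0..T}))"

(* Composite trapezoidal rule on m panels of width h. On zero panels it is 0, as
   the rule for the integral over the degenerate interval [x_0, x_0]; equivalently,
   the sum from k = 1 to -1 is read as - u 0. *)
definition trapezoid :: "real \<Rightarrow> (nat \<Rightarrow> real) \<Rightarrow> nat \<Rightarrow> real" where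
  "trapezoid h u m =
     (if m = 0 then 0 else h / 2 * (u 0 + 2 * (\<Sum>k=1..<m. u k) + u m))"

definition pc_predictor ::
  "(real \<Rightarrow> real \<Rightarrow> real \<Rightarrow> real) \<Rightarrow> (real \<Rightarrow> real) \<Rightarrow> (real \<Rightarrow> real) \<Rightarrow> (real \<Rightarrow> real) \<Rightarrow> real
   \<Rightarrow> real \<Rightarrow> real \<Rightarrow> real \<Rightarrow> nat \<Rightarrow> (nat \<Rightarrow> real) \<Rightarrow> nat \<Rightarrow> real" where
  "pc_predictor R f c\<^sub>0 \<phi> lam0 dx dt dl Nl u j =
     u j * inverse (1 + \<phi> dt * dl * f (real j * dx) *
       (\<Sum>l=0..<Nl. R (lam0 + real l * dl) (cumulative c\<^sub>0 (real j * dx)) (dx * (\<Sum>r=0..<j. u r))))"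

(* beta_j^l for v = c^{n-1}, gamma_j^l for v = p^n *)
definition pc_rate ::
  "(real \<Rightarrow> real \<Rightarrow> real \<Rightarrow> real) \<Rightarrow> (real \<Rightarrow> real) \<Rightarrow> real \<Rightarrow> real \<Rightarrow> real
   \<Rightarrow> (nat \<Rightarrow> real) \<Rightarrow> nat \<Rightarrow> nat \<Rightarrow> real" where
  "pc_rate R c\<^sub>0 lam0 dx dl v j l =
     R (lam0 + real l * dl) (cumulative c\<^sub>0 (real j * dx)) (trapezoid dx v j)"

definition pc_step ::
  "(real \<Rightarrow> real \<Rightarrow> real \<Rightarrow> real) \<Rightarrow> (real \<Rightarrow> real) \<Rightarrow> (real \<Rightarrow> real) \<Rightarrow> (real \<Rightarrow> real) \<Rightarrow> real
   \<Rightarrow> real \<Rightarrow> real \<Rightarrow> real \<Rightarrow> nat \<Rightarrow> (nat \<Rightarrow> real) \<Rightarrow> nat \<Rightarrow> real" where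
  "pc_step R f c\<^sub>0 \<phi> lam0 dx dt dl Nl u j =
     (let p = pc_predictor R f c\<^sub>0 \<phi> lam0 dx dt dl Nl u;
          \<beta> = pc_rate R c\<^sub>0 lam0 dx dl u j;
          \<gamma> = pc_rate R c\<^sub>0 lam0 dx dl p j
      in u j * exp (- (dt / 2) * f (real j * dx) * trapezoid dl (\<lambda>l. \<beta> l + \<gamma> l) Nl))"

primrec pc_scheme ::
  "(real \<Rightarrow> real \<Rightarrow> real \<Rightarrow> real) \<Rightarrow> (real \<Rightarrow> real) \<Rightarrow> (real \<Rightarrow> real) \<Rightarrow> (real \<Rightarrow> real) \<Rightarrow> real
   \<Rightarrow> real \<Rightarrow> real \<Rightarrow> real \<Rightarrow> nat \<Rightarrow> nat \<Rightarrow> nat \<Rightarrow> real" where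
  "pc_scheme R f c\<^sub>0 \<phi> lam0 dx dt dl Nl 0 = (\<lambda>j. c\<^sub>0 (real j * dx))"
| "pc_scheme R f c\<^sub>0 \<phi> lam0 dx dt dl Nl (Suc n) =
     pc_step R f c\<^sub>0 \<phi> lam0 dx dt dl Nl (pc_scheme R f c\<^sub>0 \<phi> lam0 dx dt dl Nl n)"

definition max_grid_error ::
  "(real \<Rightarrow> real \<Rightarrow> real) \<Rightarrow> (nat \<Rightarrow> nat \<Rightarrow> real) \<Rightarrow> real \<Rightarrow> real \<Rightarrow> nat \<Rightarrow> nat \<Rightarrow> real" where
  "max_grid_error c u dx dt Nx Nt =
     (MAX (n, j)\<in>{0..Nt} \<times> {0..Nx}. \<bar>c (real j * dx) (real n * dt) - u n j\<bar>)"

(* err and h give the global error and the total stepsize in terms of the numbers of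
   subintervals, all of which tend to infinity independently of each other. *)
definition convergent_of_order ::
  "nat \<Rightarrow> (nat \<times> nat \<times> nat \<Rightarrow> real) \<Rightarrow> (nat \<times> nat \<times> nat \<Rightarrow> real) \<Rightarrow> bool" where
  "convergent_of_order p h err \<longleftrightarrow>
     (err \<longlongrightarrow> 0) (at_top \<times>\<^sub>F at_top \<times>\<^sub>F at_top) \<and>
     err \<in> O[at_top \<times>\<^sub>F at_top \<times>\<^sub>F at_top](\<lambda>N. h N ^ p)"

end

theory Submission
  imports Defs
begin

text \<open>The scheme is consistent of second order and stable, and Gronwall's inequality combines the two.
The work lies in showing that the solution \<open>c\<close> is smooth enough for the quadrature rules, because it
is only assumed to be differentiable in time and integrable in space.

The smoothness used throughout is a bounded Lipschitz function \<open>q\<close> with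
\<open>\<bar>q ((1 - \<theta>) x + \<theta> y) - (1 - \<theta>) q x - \<theta> q y\<bar> \<le> K (x - y)\<^sup>2\<close>, that is, \<open>C\<^sup>1\<^sup>,\<^sup>1\<close> regularity
stated without derivatives (\<open>uniformly_regular\<close> below). It is what the trapezoidal rule needs, it
survives products and compositions, and, being linear in \<open>q\<close>, it passes under an integral sign
without differentiating there.

Write \<open>S x t\<close> for the integral of \<open>c\<close> over \<open>[0, x]\<close> and \<open>G x t\<close> for the wavelength integral of
\<open>\<rho> \<circ> \<iota>\<close>, so that \<open>c\<^sub>t = - c f G\<close>. As \<open>f G \<ge> 0\<close>, the square of \<open>c\<close> decreases, hence \<open>\<bar>c\<bar> \<le> c\<^sub>0\<close>.
Boundedness makes \<open>c\<close>, then \<open>S\<close>, then \<open>G\<close> Lipschitz in time; so \<open>c\<^sub>t\<close> is Lipschitz, and \<open>c\<close>, \<open>S\<close>,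
\<open>G\<close> are \<open>C\<^sup>1\<^sup>,\<^sup>1\<close> in time (\<open>c_regular_time\<close>). Now \<open>c\<close> is the exponential of \<open>- f \<integral> G\<close> times its initial
value (\<open>c_exponential_formula\<close>). In space the same bootstrap runs through this formula: \<open>S\<close> is Lipschitz,
hence \<open>G\<close> and \<open>c\<close> are, hence \<open>S\<close> is \<open>C\<^sup>1\<^sup>,\<^sup>1\<close>, hence \<open>G\<close> and \<open>c\<close> are (\<open>c_regular_space\<close>).

For one step, compare the exponential formula on \<open>[t, t + dt]\<close> with the corrector. The trapezoidal rule
in time costs \<open>dt\<^sup>3\<close>, those in space and wavelength cost \<open>dt (dx\<^sup>2 + dl\<^sup>2)\<close>. The predictor replaces
\<open>c (t + dt)\<close> with a one-step error \<open>dt (dx + dt + dl)\<close> only, but it is used inside a term with the factor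
\<open>dt\<close>, so first-order accuracy is enough (\<open>predictor_error\<close>, \<open>corrector_error\<close>). The
predictor and the corrector multiply by factors in \<open>[0, 1]\<close>, so numerical values stay between \<open>0\<close> and the
maximum of \<open>c\<^sub>0\<close>, and \<open>R\<close> is Lipschitz on the bounded range of the resulting masses. An error \<open>e\<close> therefore becomes at most \<open>e + C dt (e + h\<^sup>2)\<close> in one step,
and \<open>global_error\<close> sums these up.\<close>

section \<open>Lipschitz functions with quadratic interpolation error\<close>

text \<open>For \<open>k = 1\<close> this is a bounded Lipschitz function, for \<open>k \<ge> 2\<close> a bounded function of class \<open>C\<^sup>1\<^sup>,\<^sup>1\<close>: the
last clause bounds the error of linear interpolation and replaces a Lipschitz derivative. The order
\<open>k\<close> is a parameter because the regularity proofs run through the same closure properties twice, first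
with \<open>k = 1\<close> and then with \<open>k = 2\<close>.\<close>

definition regular :: "nat \<Rightarrow> real \<Rightarrow> real set \<Rightarrow> (real \<Rightarrow> real) \<Rightarrow> bool" where
  "regular k K A q \<longleftrightarrow> (\<forall>x\<in>A. \<bar>q x\<bar> \<le> K) \<and> (\<forall>x\<in>A. \<forall>y\<in>A. \<bar>q x - q y\<bar> \<le> K * \<bar>x - y\<bar>) \<and>
     (k \<ge> 2 \<longrightarrow> (\<forall>x\<in>A. \<forall>y\<in>A. \<forall>\<theta>\<in>{0..1}.
        \<bar>q ((1 - \<theta>) * x + \<theta> * y) - ((1 - \<theta>) * q x + \<theta> * q y)\<bar> \<le> K * (x - y)\<^sup>2))"

lemma regularI:
  assumes "\<And>x. x \<in> A \<Longrightarrow> \<bar>q x\<bar> \<le> K"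
    and "\<And>x y. x \<in> A \<Longrightarrow> y \<in> A \<Longrightarrow> \<bar>q x - q y\<bar> \<le> K * \<bar>x - y\<bar>"
    and "\<And>x y \<theta>. k \<ge> 2 \<Longrightarrow> x \<in> A \<Longrightarrow> y \<in> A \<Longrightarrow> 0 \<le> \<theta> \<Longrightarrow> \<theta> \<le> 1 \<Longrightarrow>
           \<bar>q ((1 - \<theta>) * x + \<theta> * y) - ((1 - \<theta>) * q x + \<theta> * q y)\<bar> \<le> K * (x - y)\<^sup>2"
  shows "regular k K A q"
  using assms unfolding regular_def by auto

lemma regular_bound: "regular k K A q \<Longrightarrow> x \<in> A \<Longrightarrow> \<bar>q x\<bar> \<le> K"
  and regular_Lipschitz: "regular k K A q \<Longrightarrow> x \<in> A \<Longrightarrow> y \<in> A \<Longrightarrow> \<bar>q x - q y\<bar> \<le> K * \<bar>x - y\<bar>"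
  and regular_interpolation: "regular k K A q \<Longrightarrow> k \<ge> 2 \<Longrightarrow> x \<in> A \<Longrightarrow> y \<in> A \<Longrightarrow> 0 \<le> \<theta> \<Longrightarrow> \<theta> \<le> 1 \<Longrightarrow>
     \<bar>q ((1 - \<theta>) * x + \<theta> * y) - ((1 - \<theta>) * q x + \<theta> * q y)\<bar> \<le> K * (x - y)\<^sup>2"
  unfolding regular_def by auto

lemma convex_point:
  fixes x y :: real
  assumes "convex A" "x \<in> A" "y \<in> A" "0 \<le> \<theta>" "\<theta> \<le> 1"
  shows "(1 - \<theta>) * x + \<theta> * y \<in> A"
  using convexD[OF assms(1-3), of "1 - \<theta>" \<theta>] assms by simp

lemma abs_convex_combination_le:
  fixes x y :: real
  assumes "\<bar>x\<bar> \<le> B" "\<bar>y\<bar> \<le> B" "0 \<le> \<theta>" "\<theta> \<le> 1"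
  shows "\<bar>(1 - \<theta>) * x + \<theta> * y\<bar> \<le> B"
  using convex_point[of "{-B..B}" x y \<theta>] assms by (auto simp: abs_le_iff)

lemma regular_mono:
  assumes "regular k K A q" "K \<le> M"
  shows "regular k M A q"
proof (rule regularI)
  fix x y assume xy: "x \<in> A" "y \<in> A"
  show "\<bar>q x - q y\<bar> \<le> M * \<bar>x - y\<bar>"
    using regular_Lipschitz[OF assms(1) xy] mult_right_mono[OF assms(2), of "\<bar>x-y\<bar>"] by simp
next
  fix x y \<theta> :: real assume xy: "k \<ge> 2" "x \<in> A" "y \<in> A" "0 \<le> \<theta>" "\<theta> \<le> 1"
  show "\<bar>q ((1 - \<theta>) * x + \<theta> * y) - ((1 - \<theta>) * q x + \<theta> * q y)\<bar> \<le> M * (x - y)\<^sup>2"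
    using regular_interpolation[OF assms(1) xy] mult_right_mono[OF assms(2), of "(x-y)\<^sup>2"] by simp
qed (use regular_bound[OF assms(1)] assms(2) in fastforce)

lemma regular_continuous_on: "regular k K A q \<Longrightarrow> continuous_on A q"
proof (cases "K \<ge> 0")
  case True
  assume "regular k K A q"
  then have "K-lipschitz_on A q"
    using True by (intro lipschitz_onI) (auto simp: dist_real_def regular_Lipschitz)
  then show ?thesis by (rule lipschitz_on_continuous_on)
next
  case False
  assume "regular k K A q"
  then have "A = {}" using False regular_bound[of k K A q] by force
  then show ?thesis by simp
qed

lemma regular_add:
  assumes a: "regular k K A a" and b: "regular k M A b"
  shows "regular k (K + M) A (\<lambda>x. a x + b x)"
proof (rule regularI)
  fix x assume "x \<in> A"
  then show "\<bar>a x + b x\<bar> \<le> K + M"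
    using regular_bound[OF a, of x] regular_bound[OF b, of x] by linarith
next
  fix x y assume xy: "x \<in> A" "y \<in> A"
  show "\<bar>a x + b x - (a y + b y)\<bar> \<le> (K + M) * \<bar>x - y\<bar>"
    using regular_Lipschitz[OF a xy] regular_Lipschitz[OF b xy] by (simp add: distrib_right)
next
  fix x y \<theta> :: real assume xy: "k \<ge> 2" "x \<in> A" "y \<in> A" "0 \<le> \<theta>" "\<theta> \<le> 1"
  let ?z = "(1 - \<theta>) * x + \<theta> * y"
  have "a ?z + b ?z - ((1 - \<theta>) * (a x + b x) + \<theta> * (a y + b y)) =
      (a ?z - ((1 - \<theta>) * a x + \<theta> * a y)) + (b ?z - ((1 - \<theta>) * b x + \<theta> * b y))"
    by (simp add: algebra_simps)
  then show "\<bar>a ?z + b ?z - ((1 - \<theta>) * (a x + b x) + \<theta> * (a y + b y))\<bar> \<le> (K + M) * (x - y)\<^sup>2"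
    using regular_interpolation[OF a xy] regular_interpolation[OF b xy]
    unfolding distrib_right by linarith
qed

text \<open>The interpolation error of a product consists of the two interpolation errors of the factors and of
the defect of the product of the interpolants, which is \<open>\<theta> (1 - \<theta>) (a x - a y) (b x - b y)\<close> and
quadratic by the Lipschitz bounds.\<close>

lemma regular_mult:
  assumes a: "regular k K A a" and b: "regular k M A b" and "convex A"
  shows "regular k (3 * K * M) A (\<lambda>x. a x * b x)"
proof (cases "A = {}")
  case True
  then show ?thesis by (simp add: regular_def)
next
  case False
  then have KM: "K \<ge> 0" "M \<ge> 0"
    using regular_bound[OF a] regular_bound[OF b] by (force)+
  show ?thesis
  proof (rule regularI)
    fix x assume x: "x \<in> A"
    have "\<bar>a x\<bar> * \<bar>b x\<bar> \<le> K * M"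
      using KM by (intro mult_mono regular_bound[OF a x] regular_bound[OF b x]) auto
    then show "\<bar>a x * b x\<bar> \<le> 3 * K * M" 
      using mult_nonneg_nonneg[OF KM] by (simp add: abs_mult)
  next
    fix x y assume xy: "x \<in> A" "y \<in> A"
    have "\<bar>(a x - a y) * b x\<bar> \<le> (K * \<bar>x - y\<bar>) * M" "\<bar>a y * (b x - b y)\<bar> \<le> K * (M * \<bar>x - y\<bar>)"
      unfolding abs_mult using KM xy
      by (auto intro!: mult_mono regular_Lipschitz[OF a] regular_Lipschitz[OF b]
          regular_bound[OF a] regular_bound[OF b])
    moreover have "a x * b x - a y * b y = (a x - a y) * b x + a y * (b x - b y)"
      by (simp add: algebra_simps)
    moreover have "0 \<le> K * M * \<bar>x - y\<bar>" using KM by simp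
    ultimately show "\<bar>a x * b x - a y * b y\<bar> \<le> 3 * K * M * \<bar>x - y\<bar>"
      by (simp add: mult.assoc mult.left_commute mult.commute)
  next
    fix x y \<theta> :: real assume xy: "k \<ge> 2" "x \<in> A" "y \<in> A" "0 \<le> \<theta>" "\<theta> \<le> 1"
    define z a' b' where "z = (1 - \<theta>) * x + \<theta> * y" and "a' = (1 - \<theta>) * a x + \<theta> * a y"
      and "b' = (1 - \<theta>) * b x + \<theta> * b y"
    have z: "z \<in> A" unfolding z_def using xy assms(3) by (intro convex_point)
    have "\<bar>a'\<bar> \<le> K"
      unfolding a'_def using xy by (intro abs_convex_combination_le regular_bound[OF a])
    moreover have "\<bar>a z - a'\<bar> \<le> K * (x - y)\<^sup>2" "\<bar>b z - b'\<bar> \<le> M * (x - y)\<^sup>2"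
      using regular_interpolation[OF a xy] regular_interpolation[OF b xy]
      unfolding z_def a'_def b'_def by auto
    ultimately have 1: "\<bar>(a z - a') * b z\<bar> \<le> (K * (x - y)\<^sup>2) * M" "\<bar>a' * (b z - b')\<bar> \<le> K * (M * (x - y)\<^sup>2)"
      unfolding abs_mult using KM xy z
      by (auto intro!: mult_mono regular_bound[OF b])
    have "\<bar>(\<theta> * (1 - \<theta>)) * ((a x - a y) * (b x - b y))\<bar> \<le> 1 * ((K * \<bar>x - y\<bar>) * (M * \<bar>x - y\<bar>))"
      unfolding abs_mult using KM xy mult_mono[of \<theta> 1 "1 - \<theta>" 1]
      by (intro mult_mono regular_Lipschitz[OF a] regular_Lipschitz[OF b]) auto
    also have "\<dots> = K * M * (x - y)\<^sup>2"
      by (simp add: power2_eq_square[of "x - y"] abs_mult_self_eq algebra_simps)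
    finally have 2: "\<bar>\<theta> * (1 - \<theta>) * ((a x - a y) * (b x - b y))\<bar> \<le> K * M * (x - y)\<^sup>2" .
    have "a z * b z - ((1 - \<theta>) * (a x * b x) + \<theta> * (a y * b y)) =
       (a z - a') * b z + a' * (b z - b') - \<theta> * (1 - \<theta>) * ((a x - a y) * (b x - b y))"
      unfolding a'_def b'_def by (simp add: algebra_simps)
    with 1 2 show "\<bar>a z * b z - ((1 - \<theta>) * (a x * b x) + \<theta> * (a y * b y))\<bar> \<le> 3 * K * M * (x - y)\<^sup>2"
      by (simp add: mult.assoc mult.left_commute mult.commute)
  qed
qed

text \<open>At the intermediate point \<open>q\<close> differs from its interpolant by a quadratic term, which the Lipschitz bound
of \<open>F\<close> preserves; \<open>F\<close> at the interpolant is then an interpolation between \<open>q x\<close> and \<open>q y\<close>, points at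
distance at most \<open>K \<bar>x - y\<bar>\<close>.\<close>

lemma regular_compose:
  assumes F: "regular k M B F" and q: "regular k K A q" and B: "convex B" "\<And>x. x \<in> A \<Longrightarrow> q x \<in> B"
    and "convex A"
  shows "regular k (M * (1 + K + K\<^sup>2)) A (\<lambda>x. F (q x))"
proof (cases "A = {}")
  case True
  then show ?thesis by (simp add: regular_def)
next
  case False
  then have KM: "K \<ge> 0" "M \<ge> 0"
    using regular_bound[OF q] regular_bound[OF F] B by (force)+
  then have C: "M \<le> M * (1 + K + K\<^sup>2)" "M * K \<le> M * (1 + K + K\<^sup>2)" "M * K + M * K\<^sup>2 \<le> M * (1 + K + K\<^sup>2)"
    by (simp_all add: distrib_left)
  show ?thesis
  proof (rule regularI)
    fix x assume "x \<in> A"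
    then show "\<bar>F (q x)\<bar> \<le> M * (1 + K + K\<^sup>2)"
      using regular_bound[OF F B(2)] C(1) by force
  next
    fix x y assume xy: "x \<in> A" "y \<in> A"
    have "\<bar>F (q x) - F (q y)\<bar> \<le> M * \<bar>q x - q y\<bar>"
      using xy B by (intro regular_Lipschitz[OF F])
    also have "\<dots> \<le> M * (K * \<bar>x - y\<bar>)"
      using KM xy by (intro mult_left_mono regular_Lipschitz[OF q])
    also have "\<dots> \<le> (M * (1 + K + K\<^sup>2)) * \<bar>x - y\<bar>"
      using C(2) unfolding mult.assoc[symmetric] by (intro mult_right_mono) auto
    finally show "\<bar>F (q x) - F (q y)\<bar> \<le> (M * (1 + K + K\<^sup>2)) * \<bar>x - y\<bar>" .
  next
    fix x y \<theta> :: real assume xy: "k \<ge> 2" "x \<in> A" "y \<in> A" "0 \<le> \<theta>" "\<theta> \<le> 1"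
    define z q' where "z = (1 - \<theta>) * x + \<theta> * y" and "q' = (1 - \<theta>) * q x + \<theta> * q y"
    have z: "z \<in> A" unfolding z_def using xy assms(5) by (intro convex_point)
    have q': "q' \<in> B" unfolding q'_def using xy B by (intro convex_point) auto
    have "\<bar>F (q z) - F q'\<bar> \<le> M * \<bar>q z - q'\<bar>"
      using z q' B by (intro regular_Lipschitz[OF F])
    also have "\<dots> \<le> M * (K * (x - y)\<^sup>2)"
      unfolding z_def q'_def using KM xy by (intro mult_left_mono regular_interpolation[OF q])
    finally have 1: "\<bar>F (q z) - F q'\<bar> \<le> M * (K * (x - y)\<^sup>2)" .
    have "\<bar>F q' - ((1 - \<theta>) * F (q x) + \<theta> * F (q y))\<bar> \<le> M * (q x - q y)\<^sup>2"
      unfolding q'_def using xy B by (intro regular_interpolation[OF F]) auto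
    also have "\<dots> \<le> M * (K * \<bar>x - y\<bar>)\<^sup>2"
      using KM regular_Lipschitz[OF q xy(2,3)] by (intro mult_left_mono) (auto simp: abs_le_square_iff[symmetric])
    finally have 2: "\<bar>F q' - ((1 - \<theta>) * F (q x) + \<theta> * F (q y))\<bar> \<le> M * (K * \<bar>x - y\<bar>)\<^sup>2" .
    have "\<bar>F (q z) - ((1 - \<theta>) * F (q x) + \<theta> * F (q y))\<bar> \<le> (M * K + M * K\<^sup>2) * (x - y)\<^sup>2"
      using 1 2 by (simp add: algebra_simps power_mult_distrib)
    also have "\<dots> \<le> (M * (1 + K + K\<^sup>2)) * (x - y)\<^sup>2"
      using C(3) by (intro mult_right_mono) auto
    finally show "\<bar>F (q z) - ((1 - \<theta>) * F (q x) + \<theta> * F (q y))\<bar> \<le> (M * (1 + K + K\<^sup>2)) * (x - y)\<^sup>2" .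
  qed
qed

lemma abs_integral_le:
  fixes g :: "real \<Rightarrow> real"
  assumes "a \<le> b" "g integrable_on {a..b}" "\<And>s. s \<in> {a..b} \<Longrightarrow> \<bar>g s\<bar> \<le> B"
  shows "\<bar>integral {a..b} g\<bar> \<le> B * (b - a)"
proof -
  have "B \<ge> 0" using assms(3)[of a] assms(1) by auto
  then show ?thesis
    using has_integral_bound[of B g "integral {a..b} g" a b] assms by (simp add: integrable_integral)
qed

text \<open>Each of the three bounds concerns a linear expression in the integrand and can be integrated.\<close>

lemma regular_integral:
  assumes q: "\<And>s. s \<in> {a..b} \<Longrightarrow> regular k K A (q s)"
    and int: "\<And>x. x \<in> A \<Longrightarrow> (\<lambda>s. q s x) integrable_on {a..b}"
    and "a \<le> b" "convex A"
  shows "regular k (K * (b - a)) A (\<lambda>x. integral {a..b} (\<lambda>s. q s x))"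
proof (rule regularI)
  fix x assume "x \<in> A"
  then show "\<bar>integral {a..b} (\<lambda>s. q s x)\<bar> \<le> K * (b - a)"
    using assms regular_bound[OF q] by (intro abs_integral_le)
next
  fix x y assume xy: "x \<in> A" "y \<in> A"
  have "\<bar>integral {a..b} (\<lambda>s. q s x - q s y)\<bar> \<le> (K * \<bar>x - y\<bar>) * (b - a)"
    using assms xy regular_Lipschitz[OF q] by (intro abs_integral_le integrable_diff)
  then show "\<bar>integral {a..b} (\<lambda>s. q s x) - integral {a..b} (\<lambda>s. q s y)\<bar> \<le> K * (b - a) * \<bar>x - y\<bar>"
    using int xy by (simp add: integral_diff mult_ac)
next
  fix x y \<theta> :: real assume xy: "k \<ge> 2" "x \<in> A" "y \<in> A" "0 \<le> \<theta>" "\<theta> \<le> 1"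
  define z where "z = (1 - \<theta>) * x + \<theta> * y"
  have z: "z \<in> A" unfolding z_def using xy assms(4) by (intro convex_point)
  have i: "(\<lambda>s. \<theta>' * q s x') integrable_on {a..b}" if "x' \<in> A" for \<theta>' x'
    using int[OF that] integrable_on_cmult_left[of "\<lambda>s. q s x'" "{a..b}" \<theta>'] by simp
  have "\<bar>integral {a..b} (\<lambda>s. q s z - ((1 - \<theta>) * q s x + \<theta> * q s y))\<bar> \<le> (K * (x - y)\<^sup>2) * (b - a)"
    using assms xy z i regular_interpolation[OF q, of _ x y \<theta>, folded z_def]
    by (intro abs_integral_le integrable_diff integrable_add)
  also have "integral {a..b} (\<lambda>s. q s z - ((1 - \<theta>) * q s x + \<theta> * q s y)) =
     integral {a..b} (\<lambda>s. q s z) - ((1 - \<theta>) * integral {a..b} (\<lambda>s. q s x) + \<theta> * integral {a..b} (\<lambda>s. q s y))"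
    using i int xy z
    by (subst integral_diff) (auto simp: integral_add integrable_add)
  finally show "\<bar>integral {a..b} (\<lambda>s. q s z) - ((1 - \<theta>) * integral {a..b} (\<lambda>s. q s x) +
      \<theta> * integral {a..b} (\<lambda>s. q s y))\<bar> \<le> K * (b - a) * (x - y)\<^sup>2"
    by (simp add: mult_ac)
qed

lemma Lipschitz_from_derivative:
  fixes q q' :: "real \<Rightarrow> real"
  assumes "convex A" "\<And>x. x \<in> A \<Longrightarrow> (q has_real_derivative q' x) (at x within A)"
    and "\<And>x. x \<in> A \<Longrightarrow> \<bar>q' x\<bar> \<le> K" and "x \<in> A" "y \<in> A"
  shows "\<bar>q x - q y\<bar> \<le> K * \<bar>x - y\<bar>"
  using field_differentiable_bound[of A q q' K x y] assms by simp

text \<open>For the interpolation error, subtract from \<open>q\<close> its tangent at the intermediate point. This does not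
change the error, since the tangent is affine, and leaves a function that vanishes at that point and
has slope at most \<open>K \<bar>x - y\<bar>\<close> between \<open>x\<close> and \<open>y\<close>.\<close>

lemma regular_from_derivative:
  fixes q q' :: "real \<Rightarrow> real"
  assumes A: "convex A" and der: "\<And>x. x \<in> A \<Longrightarrow> (q has_real_derivative q' x) (at x within A)"
    and bd: "\<And>x. x \<in> A \<Longrightarrow> \<bar>q x\<bar> \<le> K" "\<And>x. x \<in> A \<Longrightarrow> \<bar>q' x\<bar> \<le> K"
    and lip: "\<And>x y. x \<in> A \<Longrightarrow> y \<in> A \<Longrightarrow> \<bar>q' x - q' y\<bar> \<le> K * \<bar>x - y\<bar>"
  shows "regular k K A q"
proof (rule regularI)
  fix x y assume "x \<in> A" "y \<in> A"
  then show "\<bar>q x - q y\<bar> \<le> K * \<bar>x - y\<bar>" using A der bd(2) by (rule Lipschitz_from_derivative[rotated 3])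
next
  fix x y \<theta> :: real assume xy: "k \<ge> 2" "x \<in> A" "y \<in> A" "0 \<le> \<theta>" "\<theta> \<le> 1"
  define z where "z = (1 - \<theta>) * x + \<theta> * y"
  define J where "J = closed_segment x y"
  have J: "J \<subseteq> A" "convex J" "x \<in> J" "y \<in> J"
    using A xy by (auto simp: J_def closed_segment_subset)
  have z: "z \<in> J" unfolding J_def z_def using xy by (auto simp: in_segment)
  have K: "K \<ge> 0" using bd(1)[OF xy(2)] by linarith
  \<comment> \<open>the remainder after subtracting the tangent at \<open>z\<close>\<close>
  define w where "w s = q s - q z - q' z * (s - z)" for s
  have dw: "(w has_real_derivative q' s - q' z) (at s within J)" if "s \<in> J" for s
    unfolding w_def using that J
    by (auto intro!: derivative_eq_intros has_field_derivative_subset[OF der])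
  have dist: "\<bar>s - r\<bar> \<le> \<bar>x - y\<bar>" if "s \<in> J" "r \<in> J" for s r
    using that unfolding J_def closed_segment_eq_real_ivl by (auto split: if_splits)
  have slope: "\<bar>q' s - q' z\<bar> \<le> K * \<bar>x - y\<bar>" if "s \<in> J" for s
    using lip[of s z] mult_left_mono[OF dist[OF that z] K] that z J by fastforce
  have b: "\<bar>w s\<bar> \<le> K * (x - y)\<^sup>2" if "s \<in> J" for s
  proof -
    have "\<bar>w s - w z\<bar> \<le> (K * \<bar>x - y\<bar>) * \<bar>s - z\<bar>"
      by (rule Lipschitz_from_derivative[OF J(2) dw]) (use that z slope in auto)
    also have "\<dots> \<le> (K * \<bar>x - y\<bar>) * \<bar>x - y\<bar>"
      using K dist[OF that z] by (intro mult_left_mono) auto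
    also have "\<dots> = K * (x - y)\<^sup>2"
      by (simp add: power2_eq_square[of "x - y"] mult.assoc)
    finally show ?thesis by (simp add: w_def)
  qed
  have "q z - ((1 - \<theta>) * q x + \<theta> * q y) = - ((1 - \<theta>) * w x + \<theta> * w y)"
    unfolding w_def z_def by (simp add: algebra_simps)
  then show "\<bar>q z - ((1 - \<theta>) * q x + \<theta> * q y)\<bar> \<le> K * (x - y)\<^sup>2"
    using abs_convex_combination_le[OF b[OF J(3)] b[OF J(4)] xy(4,5)] by simp
qed (rule bd)

lemma C2_on_regular:
  assumes "C2_on g S" "compact A" "convex A" "A \<subseteq> S"
  shows "\<exists>K. regular k K A g"
proof -
  obtain g' g'' where S: "\<And>x. x \<in> S \<Longrightarrow> (g has_real_derivative g' x) (at x within S)"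
      "\<And>x. x \<in> S \<Longrightarrow> (g' has_real_derivative g'' x) (at x within S)" "continuous_on S g''"
    using assms(1) unfolding C2_on_def by auto
  have g: "(g has_real_derivative g' x) (at x within A)"
      "(g' has_real_derivative g'' x) (at x within A)" if "x \<in> A" for x
    using S(1,2)[of x] that assms(4) by (auto intro: has_field_derivative_subset)
  have g2: "continuous_on A g''"
    using S(3) assms(4) by (rule continuous_on_subset)
  have bounded: "\<exists>B. \<forall>x\<in>A. \<bar>u x\<bar> \<le> B" if "continuous_on A u" for u :: "real \<Rightarrow> real"
    using compact_imp_bounded[OF compact_continuous_image[OF that assms(2)]]
    by (auto simp: bounded_iff)
  have "continuous_on A g" "continuous_on A g'"
    using g(1,2) by (auto intro: DERIV_continuous_on)
  then obtain B0 B1 B2 where B: "\<forall>x\<in>A. \<bar>g x\<bar> \<le> B0" "\<forall>x\<in>A. \<bar>g' x\<bar> \<le> B1" "\<forall>x\<in>A. \<bar>g'' x\<bar> \<le> B2"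
    using bounded g2 by metis
  let ?K = "max B0 (max B1 B2)"
  have "regular k ?K A g"
  proof (rule regular_from_derivative[OF assms(3) g(1)])
    fix x y assume "x \<in> A" "y \<in> A"
    then show "\<bar>g' x - g' y\<bar> \<le> ?K * \<bar>x - y\<bar>"
      using B by (intro Lipschitz_from_derivative[OF assms(3) g(2)]) force+
  qed (use B in force)+
  then show ?thesis by blast
qed

section \<open>Regularity uniform in a parameter\<close>

text \<open>One constant serves all parameters \<open>p\<close>. This uniformity is what makes the constants of the error
estimates independent of the grid point and of the step sizes.\<close>

definition uniformly_regular :: "nat \<Rightarrow> 'p set \<Rightarrow> real set \<Rightarrow> ('p \<Rightarrow> real \<Rightarrow> real) \<Rightarrow> bool" where
  "uniformly_regular k P A q \<longleftrightarrow> (\<exists>K. \<forall>p\<in>P. regular k K A (q p))"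

lemma uniformly_regularE:
  assumes "uniformly_regular k P A q"
  obtains K where "K \<ge> 0" "\<forall>p\<in>P. regular k K A (q p)"
proof -
  obtain K where K: "\<forall>p\<in>P. regular k K A (q p)"
    using assms by (auto simp: uniformly_regular_def)
  show thesis
    using K regular_mono[of k K A _ "max K 0"] by (intro that[of "max K 0"]) auto
qed

lemma uniformly_regular_reindex:
  assumes "uniformly_regular k P A q" "\<And>r. r \<in> Q \<Longrightarrow> g r \<in> P"
  shows "uniformly_regular k Q A (\<lambda>r. q (g r))"
  using assms unfolding uniformly_regular_def by blast

text \<open>Convexity is required because the interpolation error also evaluates the functions at an
intermediate point.\<close>

lemma uniformly_regular_cong:
  assumes "uniformly_regular k P A r" and eq: "\<And>p x. p \<in> P \<Longrightarrow> x \<in> A \<Longrightarrow> q p x = r p x" and "convex A"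
  shows "uniformly_regular k P A q"
proof -
  obtain K where K: "K \<ge> 0" "\<forall>p\<in>P. regular k K A (r p)"
    using assms(1) by (rule uniformly_regularE)
  have "regular k K A (q p)" if p: "p \<in> P" for p
  proof (rule regularI)
    fix x y \<theta> :: real assume "k \<ge> 2" "x \<in> A" "y \<in> A" "0 \<le> \<theta>" "\<theta> \<le> 1"
    then show "\<bar>q p ((1 - \<theta>) * x + \<theta> * y) - ((1 - \<theta>) * q p x + \<theta> * q p y)\<bar> \<le> K * (x - y)\<^sup>2"
      using regular_interpolation[OF K(2)[rule_format, OF p]] eq[OF p] convex_point[OF assms(3)] by simp
  qed (simp_all add: eq[OF p] regular_bound[OF K(2)[rule_format, OF p]] regular_Lipschitz[OF K(2)[rule_format, OF p]])
  then show ?thesis unfolding uniformly_regular_def by blast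
qed

lemma uniformly_regular_const:
  assumes "\<And>p. p \<in> P \<Longrightarrow> \<bar>g p\<bar> \<le> B"
  shows "uniformly_regular k P A (\<lambda>p x. g p)"
proof -
  have "regular k (max B 0) A (\<lambda>x. g p)" if "p \<in> P" for p
    using assms[OF that] by (intro regularI) (auto simp: algebra_simps)
  then show ?thesis unfolding uniformly_regular_def by blast
qed

lemma uniformly_regular_ident: "uniformly_regular k P {a..b} (\<lambda>p x. x)"
proof -
  have "regular k (max 1 (max \<bar>a\<bar> \<bar>b\<bar>)) {a..b} (\<lambda>x. x)"
  proof (rule regularI)
    fix x y :: real
    show "\<bar>x - y\<bar> \<le> max 1 (max \<bar>a\<bar> \<bar>b\<bar>) * \<bar>x - y\<bar>"
      using mult_right_mono[of 1 "max 1 (max \<bar>a\<bar> \<bar>b\<bar>)" "\<bar>x - y\<bar>"] by simp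
  qed auto
  then show ?thesis unfolding uniformly_regular_def by blast
qed

lemma uniformly_regular_add:
  assumes "uniformly_regular k P A a" "uniformly_regular k P A b"
  shows "uniformly_regular k P A (\<lambda>p x. a p x + b p x)"
proof -
  obtain K M where "\<And>p. p \<in> P \<Longrightarrow> regular k K A (a p)" "\<And>p. p \<in> P \<Longrightarrow> regular k M A (b p)"
    using assms(1,2) unfolding uniformly_regular_def by blast
  then show ?thesis
    using regular_add[of k _ A _ _ _] unfolding uniformly_regular_def by blast
qed

lemma uniformly_regular_mult:
  assumes "uniformly_regular k P A a" "uniformly_regular k P A b" "convex A"
  shows "uniformly_regular k P A (\<lambda>p x. a p x * b p x)"
proof -
  obtain K M where "\<And>p. p \<in> P \<Longrightarrow> regular k K A (a p)" "\<And>p. p \<in> P \<Longrightarrow> regular k M A (b p)"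
    using assms(1,2) unfolding uniformly_regular_def by blast
  then show ?thesis
    using regular_mult[of k _ A _ _ _] assms(3) unfolding uniformly_regular_def by blast
qed

lemma uniformly_regular_cmult:
  assumes "uniformly_regular k P A a" "convex A"
  shows "uniformly_regular k P A (\<lambda>p x. r * a p x)"
  using assms by (intro uniformly_regular_mult uniformly_regular_const[of _ _ "\<bar>r\<bar>"]) auto

text \<open>A uniformly regular family is uniformly bounded, so that only a compact part of \<open>S\<close> matters, and
there a \<open>C\<^sup>2\<close> function has bounded derivatives.\<close>

lemma uniformly_regular_compose:
  assumes F: "C2_on F S" "closed S" "convex S" and q: "uniformly_regular k P A q"
    and "convex A" "\<And>p x. p \<in> P \<Longrightarrow> x \<in> A \<Longrightarrow> q p x \<in> S"
  shows "uniformly_regular k P A (\<lambda>p x. F (q p x))"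
proof -
  obtain K where K: "K \<ge> 0" "\<forall>p\<in>P. regular k K A (q p)"
    using q by (rule uniformly_regularE)
  define B where "B = S \<inter> {-K..K}"
  have B: "convex B" "compact B" unfolding B_def using F by (auto intro: convex_Int closed_Int_compact)
  obtain M where M: "regular k M B F"
    using C2_on_regular[OF F(1) B(2,1)] unfolding B_def by blast
  have "q p x \<in> B" if "p \<in> P" "x \<in> A" for p x
    using assms(6)[OF that] regular_bound[OF K(2)[rule_format, OF that(1)] that(2)] unfolding B_def
    by (auto simp: abs_le_iff)
  then have "regular k (M * (1 + K + K\<^sup>2)) A (\<lambda>x. F (q p x))" if "p \<in> P" for p
    using that B assms(5) by (intro regular_compose[OF M K(2)[rule_format]])
  then show ?thesis unfolding uniformly_regular_def by blast
qed

lemma C2_on_exp: "C2_on exp UNIV"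
  unfolding C2_on_def by (intro exI[of _ exp]) (auto intro!: derivative_eq_intros continuous_intros)

lemma uniformly_regular_exp:
  assumes "uniformly_regular k P A q" "convex A"
  shows "uniformly_regular k P A (\<lambda>p x. exp (q p x))"
  using uniformly_regular_compose[OF C2_on_exp] assms by auto

text \<open>The limits may depend on the parameter, as in integrals over \<open>[0, x]\<close> and \<open>[0, t]\<close>; the integrand
is then a family over pairs \<open>(p, s)\<close> of a parameter and an integration point.\<close>

lemma uniformly_regular_integral:
  fixes a b :: "'p \<Rightarrow> real" and q :: "'p \<Rightarrow> real \<Rightarrow> real \<Rightarrow> real"
  assumes q: "uniformly_regular k Q A (\<lambda>r x. q (fst r) (snd r) x)"
    and Q: "\<And>p s. p \<in> P \<Longrightarrow> s \<in> {a p..b p} \<Longrightarrow> (p, s) \<in> Q"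
    and int: "\<And>p x. p \<in> P \<Longrightarrow> x \<in> A \<Longrightarrow> (\<lambda>s. q p s x) integrable_on {a p..b p}"
    and ab: "\<And>p. p \<in> P \<Longrightarrow> a p \<le> b p \<and> b p - a p \<le> D" and "convex A"
  shows "uniformly_regular k P A (\<lambda>p x. integral {a p..b p} (\<lambda>s. q p s x))"
proof -
  obtain K where K: "K \<ge> 0" "\<forall>r\<in>Q. regular k K A (q (fst r) (snd r))"
    using q by (rule uniformly_regularE)
  have "regular k (K * D) A (\<lambda>x. integral {a p..b p} (\<lambda>s. q p s x))" if "p \<in> P" for p
  proof (rule regular_mono)
    show "regular k (K * (b p - a p)) A (\<lambda>x. integral {a p..b p} (\<lambda>s. q p s x))"
      using that K(2)[rule_format, OF Q] int ab assms(5) by (intro regular_integral) auto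
  qed (use ab[OF that] K(1) in \<open>auto intro: mult_left_mono\<close>)
  then show ?thesis unfolding uniformly_regular_def by blast
qed

text \<open>The gain of one order that drives both bootstrap arguments.\<close>

lemma uniformly_regular_from_derivative:
  assumes "convex A" "\<And>p x. p \<in> P \<Longrightarrow> x \<in> A \<Longrightarrow> (q p has_real_derivative q' p x) (at x within A)"
    and "\<And>p x. p \<in> P \<Longrightarrow> x \<in> A \<Longrightarrow> \<bar>q p x\<bar> \<le> B" and "uniformly_regular 1 P A q'"
  shows "uniformly_regular k P A q"
proof -
  obtain K where K: "K \<ge> 0" "\<forall>p\<in>P. regular 1 K A (q' p)"
    using assms(4) by (rule uniformly_regularE)
  have "regular k (max B K) A (q p)" if "p \<in> P" for p
  proof (rule regular_from_derivative[OF assms(1,2)])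
    fix x y assume "x \<in> A" "y \<in> A"
    then show "\<bar>q' p x - q' p y\<bar> \<le> max B K * \<bar>x - y\<bar>"
      using regular_Lipschitz[OF K(2)[rule_format, OF that], of x y] mult_right_mono[of K "max B K" "\<bar>x - y\<bar>"] by auto
  next
    fix x assume "x \<in> A"
    then show "\<bar>q' p x\<bar> \<le> max B K"
      using regular_bound[OF K(2)[rule_format, OF that], of x] by (simp add: le_max_iff_disj)
  qed (use assms(3)[OF that] that in \<open>simp_all add: le_max_iff_disj\<close>)
  then show ?thesis unfolding uniformly_regular_def by blast
qed

lemma uniformly_Lipschitz_from_derivative:
  assumes "convex A" "\<And>p x. p \<in> P \<Longrightarrow> x \<in> A \<Longrightarrow> (q p has_real_derivative q' p x) (at x within A)"
    and "\<And>p x. p \<in> P \<Longrightarrow> x \<in> A \<Longrightarrow> \<bar>q p x\<bar> \<le> B" and "\<And>p x. p \<in> P \<Longrightarrow> x \<in> A \<Longrightarrow> \<bar>q' p x\<bar> \<le> B'"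
  shows "uniformly_regular 1 P A q"
proof -
  have "regular 1 (max B B') A (q p)" if p: "p \<in> P" for p
  proof (rule regularI)
    fix x y assume "x \<in> A" "y \<in> A"
    then have "\<bar>q p x - q p y\<bar> \<le> B' * \<bar>x - y\<bar>"
      using assms(4)[OF p] by (intro Lipschitz_from_derivative[OF assms(1) assms(2)[OF p]])
    also have "\<dots> \<le> max B B' * \<bar>x - y\<bar>" by (intro mult_right_mono) auto
    finally show "\<bar>q p x - q p y\<bar> \<le> max B B' * \<bar>x - y\<bar>" .
  qed (use assms(3)[OF p] in \<open>simp_all add: le_max_iff_disj\<close>)
  then show ?thesis unfolding uniformly_regular_def by blast
qed

section \<open>Quadrature errors on uniform grids\<close>

lemma regular_integrable: "regular k K A q \<Longrightarrow> {s..t} \<subseteq> A \<Longrightarrow> q integrable_on {s..t}"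
  by (meson regular_continuous_on continuous_on_subset integrable_continuous_real)

lemma rectangle_panel_error:
  assumes q: "regular k K A q" and st: "s \<le> t" "{s..t} \<subseteq> A"
  shows "\<bar>integral {s..t} q - (t - s) * q s\<bar> \<le> K * (t - s)\<^sup>2"
proof -
  have i: "q integrable_on {s..t}" using q st by (intro regular_integrable)
  have s: "s \<in> A" using st by auto
  have K: "K \<ge> 0" using regular_bound[OF q s] by linarith
  have "\<bar>q r - q s\<bar> \<le> K * (t - s)" if "r \<in> {s..t}" for r
    using regular_Lipschitz[OF q, of r s] mult_left_mono[OF _ K, of "\<bar>r - s\<bar>" "t - s"] that st s
    by force
  then have "\<bar>integral {s..t} (\<lambda>r. q r - q s)\<bar> \<le> K * (t - s) * (t - s)"
    using i st by (intro abs_integral_le integrable_diff) auto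
  then show ?thesis
    using i st by (simp add: integral_diff integrable_const_ivl power2_eq_square mult_ac)
qed

text \<open>The trapezoidal rule integrates the linear interpolant exactly, and the interpolant differs from \<open>q\<close>
by at most \<open>K (t - s)\<^sup>2\<close>.\<close>

lemma trapezoid_panel_error:
  assumes q: "regular 2 K A q" and st: "s \<le> t" "{s..t} \<subseteq> A"
  shows "\<bar>integral {s..t} q - (t - s) / 2 * (q s + q t)\<bar> \<le> K * (t - s) ^ 3"
proof (cases "s = t")
  case False
  then have less: "s < t" using st by simp
  have i: "q integrable_on {s..t}" using q st by (intro regular_integrable)
  define \<theta> where "\<theta> r = (r - s) / (t - s)" for r
  define p where "p r = (1 - \<theta> r) * q s + \<theta> r * q t" for r
  define m where "m = (q t - q s) / (t - s)"
  have p_eq: "p r = q s + m * (r - s)" for r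
    by (simp add: p_def \<theta>_def m_def algebra_simps diff_divide_distrib)
  have "(p has_integral
      ((q s * t + m * (t - s)\<^sup>2 / 2) - (q s * s + m * (s - s)\<^sup>2 / 2))) {s..t}"
    using less unfolding p_eq
    by (intro fundamental_theorem_of_calculus[of s t "\<lambda>r. q s * r + m * (r - s)\<^sup>2 / 2"])
       (auto intro!: derivative_eq_intros simp: has_real_derivative_iff_has_vector_derivative[symmetric])
  also have "(q s * t + m * (t - s)\<^sup>2 / 2) - (q s * s + m * (s - s)\<^sup>2 / 2) =
      q s * (t - s) + m * (t - s) * (t - s) / 2"
    by (simp add: power2_eq_square algebra_simps)
  also have "m * (t - s) = q t - q s"
    using less by (simp add: m_def)
  also have "q s * (t - s) + (q t - q s) * (t - s) / 2 = (t - s) / 2 * (q s + q t)"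
    by (simp add: field_simps)
  finally have p: "(p has_integral (t - s) / 2 * (q s + q t)) {s..t}" .
  have "\<bar>q r - p r\<bar> \<le> K * (t - s)\<^sup>2" if "r \<in> {s..t}" for r
  proof -
    have "(1 - \<theta> r) * s + \<theta> r * t = s + \<theta> r * (t - s)" by (simp add: algebra_simps)
    also have "\<dots> = r" using less by (simp add: \<theta>_def)
    finally have "(1 - \<theta> r) * s + \<theta> r * t = r" .
    moreover have "s \<in> A" "t \<in> A" using st by auto
    ultimately show ?thesis
      using regular_interpolation[OF q order_refl, of s t "\<theta> r"] that less
      by (simp add: p_def \<theta>_def power2_commute[of s t])
  qed
  then have "\<bar>integral {s..t} (\<lambda>r. q r - p r)\<bar> \<le> K * (t - s)\<^sup>2 * (t - s)"
    using i p st by (intro abs_integral_le integrable_diff) (auto simp: has_integral_integrable)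
  then show ?thesis
    using i p by (simp add: integral_diff has_integral_integrable integral_unique power3_eq_cube power2_eq_square mult.assoc)
qed simp

lemma trapezoid_0 [simp]: "trapezoid h u 0 = 0"
  by (simp add: trapezoid_def)

lemma trapezoid_Suc: "trapezoid h u (Suc m) = trapezoid h u m + h / 2 * (u m + u (Suc m))"
proof (cases m)
  case (Suc i)
  have "(\<Sum>k=1..<Suc m. u k) = (\<Sum>k=1..<m. u k) + u m"
    using Suc by simp
  then show ?thesis
    using Suc by (simp add: trapezoid_def algebra_simps)
qed (simp add: trapezoid_def)

lemma trapezoid_add: "trapezoid h (\<lambda>k. u k + v k) m = trapezoid h u m + trapezoid h v m"
  by (induction m) (simp_all add: trapezoid_Suc algebra_simps)

lemma trapezoid_bounds:
  assumes "h \<ge> 0" "\<And>k. k \<le> m \<Longrightarrow> a \<le> u k" "\<And>k. k \<le> m \<Longrightarrow> u k \<le> b"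
  shows "a * (real m * h) \<le> trapezoid h u m \<and> trapezoid h u m \<le> b * (real m * h)"
  using assms(2,3)
proof (induction m)
  case (Suc m)
  have "h / 2 * (a + a) \<le> h / 2 * (u m + u (Suc m))" "h / 2 * (u m + u (Suc m)) \<le> h / 2 * (b + b)"
    using Suc.prems assms(1) by (intro mult_left_mono add_mono; simp)+
  then show ?case using Suc by (simp add: trapezoid_Suc algebra_simps)
qed simp

lemma trapezoid_diff_le:
  assumes "h \<ge> 0" "\<And>k. k \<le> m \<Longrightarrow> \<bar>u k - v k\<bar> \<le> e"
  shows "\<bar>trapezoid h u m - trapezoid h v m\<bar> \<le> e * (real m * h)"
proof -
  have "trapezoid h u m = trapezoid h (\<lambda>k. u k - v k) m + trapezoid h v m"
    by (simp add: trapezoid_add[symmetric])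
  moreover have "\<bar>trapezoid h (\<lambda>k. u k - v k) m\<bar> \<le> e * (real m * h)"
    using trapezoid_bounds[of h m "- e" "\<lambda>k. u k - v k" e] assms by (force simp: abs_le_iff)
  ultimately show ?thesis by simp
qed

lemma trapezoid_error:
  assumes q: "regular 2 K {a..b} q" and h: "h \<ge> 0" "a + real m * h \<le> b"
  shows "\<bar>integral {a..a + real m * h} q - trapezoid h (\<lambda>k. q (a + real k * h)) m\<bar> \<le> K * (real m * h) * h\<^sup>2"
  using h(2)
proof (induction m)
  case (Suc m)
  let ?s = "a + real m * h" and ?t = "a + real (Suc m) * h"
  have st: "?t - ?s = h" "?s \<le> ?t" "a \<le> ?s" "{?s..?t} \<subseteq> {a..b}" "?s \<le> b"
    using h(1) Suc.prems by (auto simp: algebra_simps)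
  have "integral {a..?s} q + integral {?s..?t} q = integral {a..?t} q"
    using st Suc.prems by (intro Henstock_Kurzweil_Integration.integral_combine regular_integrable[OF q]) auto
  moreover have "\<bar>integral {?s..?t} q - h / 2 * (q ?s + q ?t)\<bar> \<le> K * h ^ 3"
    using trapezoid_panel_error[OF q st(2,4)] unfolding st(1) .
  moreover have "\<bar>integral {a..?s} q - trapezoid h (\<lambda>k. q (a + real k * h)) m\<bar> \<le> K * (real m * h) * h\<^sup>2"
    using Suc.IH st by simp
  moreover have "K * (real (Suc m) * h) * h\<^sup>2 = K * (real m * h) * h\<^sup>2 + K * h ^ 3"
    by (simp add: algebra_simps power2_eq_square power3_eq_cube)
  ultimately show ?case unfolding trapezoid_Suc by linarith
qed simp

lemma rectangle_error:
  assumes q: "regular k K {a..b} q" and h: "h \<ge> 0" "a + real m * h \<le> b"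
  shows "\<bar>integral {a..a + real m * h} q - h * (\<Sum>k<m. q (a + real k * h))\<bar> \<le> K * (real m * h) * h"
  using h(2)
proof (induction m)
  case (Suc m)
  let ?s = "a + real m * h" and ?t = "a + real (Suc m) * h"
  have st: "?t - ?s = h" "?s \<le> ?t" "a \<le> ?s" "{?s..?t} \<subseteq> {a..b}" "?s \<le> b"
    using h(1) Suc.prems by (auto simp: algebra_simps)
  have "integral {a..?s} q + integral {?s..?t} q = integral {a..?t} q"
    using st Suc.prems by (intro Henstock_Kurzweil_Integration.integral_combine regular_integrable[OF q]) auto
  moreover have "\<bar>integral {?s..?t} q - h * q ?s\<bar> \<le> K * h\<^sup>2"
    using rectangle_panel_error[OF q st(2,4)] unfolding st(1) .
  moreover have "\<bar>integral {a..?s} q - h * (\<Sum>k<m. q (a + real k * h))\<bar> \<le> K * (real m * h) * h"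
    using Suc.IH st by simp
  moreover have "K * (real (Suc m) * h) * h = K * (real m * h) * h + K * h\<^sup>2"
    by (simp add: algebra_simps power2_eq_square)
  ultimately show ?case by (simp add: distrib_left)
qed simp

lemma rectangle_diff_le:
  fixes u v :: "nat \<Rightarrow> real"
  assumes "h \<ge> 0" "\<And>k. k < m \<Longrightarrow> \<bar>u k - v k\<bar> \<le> e"
  shows "\<bar>h * (\<Sum>k<m. u k) - h * (\<Sum>k<m. v k)\<bar> \<le> e * (real m * h)"
proof -
  have "\<bar>\<Sum>k<m. u k - v k\<bar> \<le> real (card {..<m}) * e"
    using assms(2) by (intro order.trans[OF sum_abs] sum_bounded_above) auto
  then have "h * \<bar>\<Sum>k<m. u k - v k\<bar> \<le> h * (real m * e)"
    using assms(1) by (intro mult_left_mono) auto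
  then show ?thesis
    using assms(1) by (simp add: sum_subtractf right_diff_distrib[symmetric] abs_mult mult_ac)
qed

lemma trapezoid_nonneg:
  assumes "h \<ge> 0" "\<And>k. k \<le> m \<Longrightarrow> 0 \<le> u k"
  shows "0 \<le> trapezoid h u m"
  unfolding trapezoid_def using assms by (auto intro!: mult_nonneg_nonneg add_nonneg_nonneg sum_nonneg)

section \<open>Scalar estimates\<close>

lemma discrete_Gronwall:
  fixes E :: "nat \<Rightarrow> real"
  assumes "E 0 \<le> 0" "A \<ge> 0" "B \<ge> 0" "\<And>n. n < N \<Longrightarrow> E (Suc n) \<le> (1 + A) * E n + B" "n \<le> N"
  shows "E n \<le> real n * B * exp (real n * A)"
  using assms(5)
proof (induction n)
  case (Suc n)
  have "1 + A \<le> exp A" by (rule exp_ge_add_one_self)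
  have "(1 + A) * E n \<le> (1 + A) * (real n * B * exp (real n * A))"
    using Suc assms(2) by (intro mult_left_mono) auto
  also have "\<dots> \<le> exp A * (real n * B * exp (real n * A))"
    using assms(3) by (intro mult_right_mono exp_ge_add_one_self) auto
  also have "\<dots> = real n * B * exp (real (Suc n) * A)"
    by (simp add: exp_add distrib_right)
  finally have "(1 + A) * E n \<le> real n * B * exp (real (Suc n) * A)" .
  moreover have "B * 1 \<le> B * exp (real (Suc n) * A)"
    using assms(2,3) by (intro mult_left_mono) auto
  ultimately have "(1 + A) * E n + B \<le> real (Suc n) * B * exp (real (Suc n) * A)"
    by (simp add: distrib_right algebra_simps)
  moreover have "E (Suc n) \<le> (1 + A) * E n + B" using Suc.prems by (intro assms(4)) auto
  ultimately show ?case by linarith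
qed (use assms(1) in simp)

lemma exp_minus_Lipschitz:
  fixes w z :: real
  assumes "w \<ge> 0" "z \<ge> 0"
  shows "\<bar>exp (- w) - exp (- z)\<bar> \<le> \<bar>w - z\<bar>"
proof -
  have "\<bar>exp (- w) - exp (- z)\<bar> \<le> 1 * \<bar>w - z\<bar>"
    by (rule Lipschitz_from_derivative[where A = "{0..}" and q' = "\<lambda>w. - exp (- w)"])
      (use assms in \<open>auto intro!: derivative_eq_intros\<close>)
  then show ?thesis by simp
qed

text \<open>The predictor damps by \<open>1 / (1 + w)\<close>, the exact solution by \<open>exp (- z)\<close>. Both \<open>1 / (1 + w)\<close> and
\<open>exp (- w)\<close> lie between \<open>1 - w\<close> and \<open>1 - w + w\<^sup>2\<close>, and replacing \<open>w\<close> by \<open>z\<close> in the exponential costs at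
most \<open>\<bar>w - z\<bar>\<close>.\<close>

lemma implicit_Euler_factor_error:
  fixes w z :: real
  assumes "w \<ge> 0" "z \<ge> 0"
  shows "\<bar>inverse (1 + w) - exp (- z)\<bar> \<le> \<bar>w - z\<bar> + w\<^sup>2"
proof -
  have "(1 + w) * exp (- w) \<le> 1"
    using exp_ge_add_one_self[of w] by (simp add: exp_minus field_simps)
  then have "exp (- w) \<le> inverse (1 + w)"
    using assms by (simp add: field_simps)
  moreover have "inverse (1 + w) \<le> 1 - w + w\<^sup>2"
  proof -
    have "1 \<le> (1 - w + w\<^sup>2) * (1 + w)"
      using assms by (simp add: algebra_simps power2_eq_square)
    then show ?thesis using assms by (simp add: field_simps)
  qed
  moreover have "1 - w \<le> exp (- w)" using exp_ge_add_one_self[of "- w"] by simp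
  ultimately show ?thesis using exp_minus_Lipschitz[OF assms] by linarith
qed

section \<open>The photochemical model\<close>

text \<open>The solution \<open>c\<close> is one of the data. The response curve \<open>\<rho>\<close> is kept abstract, so that the estimates
visibly rest on its sign and its smoothness.\<close>

locale photochemical_problem =
  fixes L T lam0 lam1 \<mu> :: real
    and \<rho> f c\<^sub>0 I \<epsilon>\<^sub>A \<epsilon>\<^sub>B :: "real \<Rightarrow> real"
    and R :: "real \<Rightarrow> real \<Rightarrow> real \<Rightarrow> real"
    and c :: "real \<Rightarrow> real \<Rightarrow> real"
  assumes L_pos: "L > 0" and T_pos: "T > 0" and lam_less: "lam0 < lam1"
    and C2_f: "C2_on f {0..L}" and f_nonneg: "\<And>x. x \<in> {0..L} \<Longrightarrow> f x \<ge> 0"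
    and C2_c0: "C2_on c\<^sub>0 {0..L}" and c0_pos: "\<And>x. x \<in> {0..L} \<Longrightarrow> c\<^sub>0 x > 0"
    and C2_I: "C2_on I {lam0..lam1}" and I_nonneg: "\<And>l. l \<in> {lam0..lam1} \<Longrightarrow> 0 \<le> I l"
    and C2_rho: "C2_on \<rho> {0..}" and rho_nonneg: "\<And>X. X \<ge> 0 \<Longrightarrow> \<rho> X \<ge> 0"
    and C2_epsA: "C2_on \<epsilon>\<^sub>A {lam0..lam1}" and C2_epsB: "C2_on \<epsilon>\<^sub>B {lam0..lam1}"
    and R_eq: "R = (\<lambda>l y s. \<rho> (iota \<mu> I \<epsilon>\<^sub>A \<epsilon>\<^sub>B l y s))"
    and solution: "photo_solution R f c\<^sub>0 L T lam0 lam1 c"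
begin

definition mass :: "real \<Rightarrow> real \<Rightarrow> real" where
  "mass x t = integral {0..x} (\<lambda>\<xi>. c \<xi> t)"

definition rate :: "real \<Rightarrow> real \<Rightarrow> real" where
  "rate x t = integral {lam0..lam1} (\<lambda>l. R l (cumulative c\<^sub>0 x) (mass x t))"

lemma c_initial: "x \<in> {0..L} \<Longrightarrow> c x 0 = c\<^sub>0 x"
  and c_integrable: "t \<in> {0..T} \<Longrightarrow> (\<lambda>\<xi>. c \<xi> t) integrable_on {0..L}"
  and c_deriv: "x \<in> {0..L} \<Longrightarrow> t \<in> {0..T} \<Longrightarrow>
     (c x has_real_derivative - c x t * f x * rate x t) (at t within {0..T})"
  using solution unfolding photo_solution_def rate_def mass_def by auto

lemma c_integrable_subinterval:
  "t \<in> {0..T} \<Longrightarrow> 0 \<le> a \<Longrightarrow> b \<le> L \<Longrightarrow> (\<lambda>\<xi>. c \<xi> t) integrable_on {a..b}"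
  using c_integrable by (rule integrable_subinterval_real) auto

lemma R_nonneg: "l \<in> {lam0..lam1} \<Longrightarrow> R l y s \<ge> 0"
  unfolding R_eq iota_def using I_nonneg by (intro rho_nonneg) auto

text \<open>Wavelength, cumulative concentration and mass may all vary with the variable. This covers regularity
of \<open>R\<close> along the wavelength (with the other arguments constant) as well as along the solution in time
or in space (with the wavelength constant).\<close>

lemma R_regular:
  assumes A: "convex A" and l: "uniformly_regular k P A l" "\<And>p x. p \<in> P \<Longrightarrow> x \<in> A \<Longrightarrow> l p x \<in> {lam0..lam1}"
    and ys: "uniformly_regular k P A y" "uniformly_regular k P A s"
  shows "uniformly_regular k P A (\<lambda>p x. R (l p x) (y p x) (s p x))"
proof -
  have comp: "uniformly_regular k P A (\<lambda>p x. F (l p x))" if "C2_on F {lam0..lam1}" for F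
    using that l A by (intro uniformly_regular_compose[of F "{lam0..lam1}"]) auto
  have "uniformly_regular k P A (\<lambda>p x. \<rho> (I (l p x) *
      exp (- \<mu> * (\<epsilon>\<^sub>B (l p x) * y p x + (\<epsilon>\<^sub>A (l p x) + (- 1) * \<epsilon>\<^sub>B (l p x)) * s p x))))"
  proof (rule uniformly_regular_compose[OF C2_rho _ _ _ A])
    show "uniformly_regular k P A (\<lambda>p x. I (l p x) *
      exp (- \<mu> * (\<epsilon>\<^sub>B (l p x) * y p x + (\<epsilon>\<^sub>A (l p x) + (- 1) * \<epsilon>\<^sub>B (l p x)) * s p x)))"
      by (intro uniformly_regular_mult uniformly_regular_exp uniformly_regular_cmult
          uniformly_regular_add comp C2_I C2_epsA C2_epsB ys A)
    show "I (l p x) * exp (- \<mu> * (\<epsilon>\<^sub>B (l p x) * y p x +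
        (\<epsilon>\<^sub>A (l p x) + (- 1) * \<epsilon>\<^sub>B (l p x)) * s p x)) \<in> {0..}" if "p \<in> P" "x \<in> A" for p x
      using I_nonneg[OF l(2)[OF that]] by simp
  qed auto
  then show ?thesis unfolding R_eq iota_def by simp
qed

lemma R_continuous: "continuous_on {lam0..lam1} (\<lambda>l. R l y s)"
proof -
  have "uniformly_regular 1 (UNIV :: unit set) {lam0..lam1} (\<lambda>p l. R l y s)"
    by (intro R_regular uniformly_regular_ident uniformly_regular_const[of _ _ "\<bar>y\<bar>"]
        uniformly_regular_const[of _ _ "\<bar>s\<bar>"]) auto
  then show ?thesis
    unfolding uniformly_regular_def using regular_continuous_on by blast
qed

lemma R_integrable: "(\<lambda>l. R l y s) integrable_on {lam0..lam1}"
  by (intro integrable_continuous_real R_continuous)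

lemma rate_nonneg: "rate x t \<ge> 0"
  unfolding rate_def by (intro integral_nonneg R_integrable R_nonneg)

text \<open>The square of \<open>c x\<close> has the derivative \<open>- 2 c\<^sup>2 f G \<le> 0\<close>. Squaring avoids the sign of \<open>c\<close>, which is
known only after the exponential formula, and that formula presupposes a continuous rate.\<close>

lemma c_abs_le_initial:
  assumes x: "x \<in> {0..L}" and t: "t \<in> {0..T}"
  shows "\<bar>c x t\<bar> \<le> c\<^sub>0 x"
proof -
  have "(c x t)\<^sup>2 \<le> (c x 0)\<^sup>2"
  proof (rule DERIV_nonpos_imp_decreasing_open[where f = "\<lambda>t. (c x t)\<^sup>2"])
    show "0 \<le> t" using t by simp
    fix s assume s: "0 < s" "s < t"
    then have "(c x has_real_derivative - c x s * f x * rate x s) (at s)"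
      using c_deriv[OF x, of s] t by (simp add: at_within_Icc_at)
    then have "((\<lambda>t. (c x t)\<^sup>2) has_real_derivative - (2 * (c x s)\<^sup>2 * f x * rate x s)) (at s)"
      by (auto intro!: derivative_eq_intros simp: power2_eq_square)
    moreover have "0 \<le> 2 * (c x s)\<^sup>2 * f x * rate x s"
      using f_nonneg[OF x] rate_nonneg by (intro mult_nonneg_nonneg) auto
    ultimately show "\<exists>y. ((\<lambda>t. (c x t)\<^sup>2) has_real_derivative y) (at s) \<and> y \<le> 0"
      by (intro exI conjI) auto
  next
    have "continuous_on {0..T} (c x)" using c_deriv[OF x] by (rule DERIV_continuous_on)
    then show "continuous_on {0..t} (\<lambda>t. (c x t)\<^sup>2)"
      using t by (intro continuous_intros) (auto elim: continuous_on_subset)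
  qed
  then show ?thesis
    using c0_pos[OF x] c_initial[OF x] by (simp add: abs_le_square_iff[symmetric])
qed

lemma c0_bounded: obtains C where "C > 0" "\<forall>x\<in>{0..L}. c\<^sub>0 x \<le> C"
proof -
  obtain C where C: "regular 2 C {0..L} c\<^sub>0"
    using C2_on_regular[OF C2_c0, of "{0..L}"] by auto
  show thesis
    by (rule that[of "max C 1"]) (use regular_bound[OF C] in force)+
qed

lemma c_bounded: obtains C where "C > 0" "\<forall>x\<in>{0..L}. \<forall>t\<in>{0..T}. \<bar>c x t\<bar> \<le> C"
proof -
  obtain C where "C > 0" "\<forall>x\<in>{0..L}. c\<^sub>0 x \<le> C" by (rule c0_bounded)
  then show thesis by (intro that[of C]) (auto intro: order.trans[OF c_abs_le_initial])
qed

lemma c0_regular: "uniformly_regular k P {0..L} (\<lambda>p. c\<^sub>0)"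
  and f_regular: "uniformly_regular k P {0..L} (\<lambda>p. f)"
  using uniformly_regular_compose[OF C2_c0 _ _ uniformly_regular_ident[of k P 0 L]]
    uniformly_regular_compose[OF C2_f _ _ uniformly_regular_ident[of k P 0 L]]
  by auto

text \<open>The derivative \<open>c\<^sub>0\<close> of \<open>cumulative c\<^sub>0\<close> is Lipschitz.\<close>

lemma cumulative_regular: "uniformly_regular k P {0..L} (\<lambda>p. cumulative c\<^sub>0)"
proof -
  have "uniformly_regular 1 (UNIV :: unit set) {0..L} (\<lambda>p. c\<^sub>0)" by (rule c0_regular)
  then have cont: "continuous_on {0..L} c\<^sub>0"
    unfolding uniformly_regular_def using regular_continuous_on by blast
  have der: "(cumulative c\<^sub>0 has_real_derivative c\<^sub>0 x) (at x within {0..L})" if "x \<in> {0..L}" for x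
    unfolding cumulative_def[abs_def] using integral_has_real_derivative[OF cont that] .
  have "continuous_on {0..L} (cumulative c\<^sub>0)" using der by (rule DERIV_continuous_on)
  then obtain B where "\<forall>x\<in>{0..L}. \<bar>cumulative c\<^sub>0 x\<bar> \<le> B"
    using compact_imp_bounded[OF compact_continuous_image[of "{0..L}" "cumulative c\<^sub>0"]]
    by (auto simp: bounded_iff)
  then show ?thesis
    using der by (intro uniformly_regular_from_derivative[OF _ _ _ c0_regular, where B = B]) auto
qed

lemma mass_bounded: obtains D where "D > 0" "\<forall>x\<in>{0..L}. \<forall>t\<in>{0..T}. \<bar>mass x t\<bar> \<le> D"
proof -
  obtain C where C: "C > 0" "\<forall>x\<in>{0..L}. \<forall>t\<in>{0..T}. \<bar>c x t\<bar> \<le> C" by (rule c_bounded)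
  have "\<bar>mass x t\<bar> \<le> C * L" if "x \<in> {0..L}" "t \<in> {0..T}" for x t
  proof -
    have "\<bar>mass x t\<bar> \<le> C * (x - 0)"
      unfolding mass_def using that C by (intro abs_integral_le c_integrable_subinterval) auto
    also have "\<dots> \<le> C * L" using that C by (intro mult_left_mono) auto
    finally show ?thesis .
  qed
  then show thesis using C L_pos by (intro that[of "C * L"]) auto
qed

lemma rate_regular:
  assumes A: "convex A" and xt: "\<And>p z. p \<in> P \<Longrightarrow> z \<in> A \<Longrightarrow> xf p z \<in> {0..L}"
    and y: "uniformly_regular k P A (\<lambda>p z. cumulative c\<^sub>0 (xf p z))"
    and s: "uniformly_regular k P A (\<lambda>p z. mass (xf p z) (tf p z))"
  shows "uniformly_regular k P A (\<lambda>p z. rate (xf p z) (tf p z))"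
  unfolding rate_def
proof (rule uniformly_regular_integral[where Q = "P \<times> {lam0..lam1}" and D = "lam1 - lam0"])
  show "uniformly_regular k (P \<times> {lam0..lam1}) A
     (\<lambda>r z. R (snd r) (cumulative c\<^sub>0 (xf (fst r) z)) (mass (xf (fst r) z) (tf (fst r) z)))"
    by (intro R_regular[OF A] uniformly_regular_const[of _ _ "max \<bar>lam0\<bar> \<bar>lam1\<bar>"]
        uniformly_regular_reindex[OF y, of _ fst] uniformly_regular_reindex[OF s, of _ fst]) auto
qed (use A lam_less R_integrable in auto)

text \<open>Bounds on numbers are read off from a family of constant functions on a one-point set.\<close>

lemma rate_bounded: obtains M where "M > 0" "\<forall>x\<in>{0..L}. \<forall>t\<in>{0..T}. rate x t \<le> M"
proof -
  obtain D where D: "\<forall>x\<in>{0..L}. \<forall>t\<in>{0..T}. \<bar>mass x t\<bar> \<le> D" by (rule mass_bounded)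
  obtain B where B: "\<forall>p\<in>(UNIV :: unit set). regular 1 B {0..L} (cumulative c\<^sub>0)"
    using cumulative_regular[of 1 "UNIV :: unit set"] by (rule uniformly_regularE)
  have "uniformly_regular 1 ({0..L} \<times> {0..T}) {0} (\<lambda>p z. rate (fst p) (snd p))"
  proof (rule rate_regular[where xf = "\<lambda>p z. fst p" and tf = "\<lambda>p z. snd p"])
    show "uniformly_regular 1 ({0..L} \<times> {0..T}) {0} (\<lambda>p z. cumulative c\<^sub>0 (fst p))"
      using regular_bound[OF B[rule_format]] by (intro uniformly_regular_const[of _ _ B]) auto
    show "uniformly_regular 1 ({0..L} \<times> {0..T}) {0} (\<lambda>p z. mass (fst p) (snd p))"
      using D by (intro uniformly_regular_const[of _ _ D]) auto
  qed auto
  then obtain M where M: "\<forall>p\<in>{0..L} \<times> {0..T}. regular 1 M {0} (\<lambda>z. rate (fst p) (snd p))"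
    by (rule uniformly_regularE)
  have "rate x t \<le> max M 1" if "x \<in> {0..L}" "t \<in> {0..T}" for x t
    using regular_bound[OF M[rule_format, of "(x, t)"], of 0] that by auto
  then have "\<forall>x\<in>{0..L}. \<forall>t\<in>{0..T}. rate x t \<le> max M 1" by blast
  then show thesis by (rule that[rotated]) simp
qed

section \<open>Regularity in time and the exponential formula\<close>

lemma mass_regular_time_if_c:
  assumes "uniformly_regular k {0..L} {0..T} c"
  shows "uniformly_regular k {0..L} {0..T} mass"
proof -
  have "uniformly_regular k {0..L} {0..T} (\<lambda>x t. integral {0..x} (\<lambda>\<xi>. c \<xi> t))"
  proof (rule uniformly_regular_integral[where Q = "SIGMA x:{0..L}. {0..x}" and D = L])
    show "uniformly_regular k (SIGMA x:{0..L}. {0..x}) {0..T} (\<lambda>r t. c (snd r) t)"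
      by (rule uniformly_regular_reindex[OF assms]) auto
    show "(\<lambda>\<xi>. c \<xi> t) integrable_on {0..x}" if "x \<in> {0..L}" "t \<in> {0..T}" for x t
      using that by (intro c_integrable_subinterval) auto
  qed auto
  then show ?thesis unfolding mass_def[abs_def] .
qed

lemma rate_regular_time_if_mass:
  assumes "uniformly_regular k {0..L} {0..T} mass"
  shows "uniformly_regular k {0..L} {0..T} rate"
proof -
  obtain B where B: "\<forall>p\<in>(UNIV :: unit set). regular 1 B {0..L} (cumulative c\<^sub>0)"
    using cumulative_regular[of 1 "UNIV :: unit set"] by (rule uniformly_regularE)
  show ?thesis
  proof (rule rate_regular[where xf = "\<lambda>x t. x" and tf = "\<lambda>x t. t"])
    show "uniformly_regular k {0..L} {0..T} (\<lambda>x t. cumulative c\<^sub>0 x)"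
      using regular_bound[OF B[rule_format]] by (intro uniformly_regular_const[of _ _ B]) auto
  qed (use assms in auto)
qed

lemma f_bounded: obtains F where "F > 0" "\<forall>x\<in>{0..L}. \<bar>f x\<bar> \<le> F"
proof -
  obtain F where F: "\<forall>p\<in>(UNIV :: unit set). regular 1 F {0..L} f"
    using f_regular[of 1 "UNIV :: unit set"] by (rule uniformly_regularE)
  show thesis
    by (rule that[of "max F 1"]) (use regular_bound[OF F[rule_format]] in force)+
qed

text \<open>The time derivative \<open>- c f G\<close> is bounded, though not yet known to be continuous.\<close>

lemma c_Lipschitz_time: "uniformly_regular 1 {0..L} {0..T} c"
proof -
  obtain C where C: "C > 0" "\<forall>x\<in>{0..L}. \<forall>t\<in>{0..T}. \<bar>c x t\<bar> \<le> C" by (rule c_bounded)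
  obtain M where M: "M > 0" "\<forall>x\<in>{0..L}. \<forall>t\<in>{0..T}. rate x t \<le> M" by (rule rate_bounded)
  obtain F where F: "F > 0" "\<forall>x\<in>{0..L}. \<bar>f x\<bar> \<le> F" by (rule f_bounded)
  have "\<bar>- c x t * f x * rate x t\<bar> \<le> C * F * M" if "x \<in> {0..L}" "t \<in> {0..T}" for x t
    unfolding abs_mult abs_minus using that C M F rate_nonneg[of x t]
    by (intro mult_mono) auto
  then show ?thesis
    using C by (intro uniformly_Lipschitz_from_derivative[OF _ c_deriv, where B = C]) auto
qed

lemma rate_Lipschitz_time: "uniformly_regular 1 {0..L} {0..T} rate"
  by (intro rate_regular_time_if_mass mass_regular_time_if_c c_Lipschitz_time)

text \<open>By now the rate is Lipschitz in time, and so is the derivative \<open>- c f G\<close>.\<close>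

lemma c_regular_time: "uniformly_regular k {0..L} {0..T} c"
proof -
  obtain C where C: "C > 0" "\<forall>x\<in>{0..L}. \<forall>t\<in>{0..T}. \<bar>c x t\<bar> \<le> C" by (rule c_bounded)
  obtain F where F: "F > 0" "\<forall>x\<in>{0..L}. \<bar>f x\<bar> \<le> F" by (rule f_bounded)
  have "uniformly_regular 1 {0..L} {0..T} (\<lambda>x t. (- 1) * (c x t * (f x * rate x t)))"
    using F by (intro uniformly_regular_cmult uniformly_regular_mult c_Lipschitz_time
        rate_Lipschitz_time uniformly_regular_const[of _ f F]) auto
  then have "uniformly_regular 1 {0..L} {0..T} (\<lambda>x t. - c x t * f x * rate x t)"
    by (simp add: mult.assoc)
  then show ?thesis
    using C by (intro uniformly_regular_from_derivative[OF _ c_deriv, where B = C]) auto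
qed

lemma rate_regular_time: "uniformly_regular k {0..L} {0..T} rate"
  by (intro rate_regular_time_if_mass mass_regular_time_if_c c_regular_time)

lemma rate_continuous_time: "x \<in> {0..L} \<Longrightarrow> continuous_on {0..T} (rate x)"
  using rate_Lipschitz_time unfolding uniformly_regular_def by (blast intro: regular_continuous_on)

lemma rate_integrable_time:
  "x \<in> {0..L} \<Longrightarrow> 0 \<le> s \<Longrightarrow> t \<le> T \<Longrightarrow> rate x integrable_on {s..t}"
  by (rule integrable_continuous_real, rule continuous_on_subset[OF rate_continuous_time]) auto

text \<open>The integrating factor \<open>exp (f x * \<integral> rate)\<close> is available because the rate is continuous in time.\<close>

lemma c_exponential_formula:
  assumes x: "x \<in> {0..L}" and st: "0 \<le> s" "s \<le> t" "t \<le> T"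
  shows "c x t = c x s * exp (- (f x * integral {s..t} (rate x)))"
proof -
  define H where "H r = integral {0..r} (rate x)" for r
  have H: "(H has_real_derivative rate x r) (at r within {0..T})" if "r \<in> {0..T}" for r
    unfolding H_def[abs_def] using integral_has_real_derivative[OF rate_continuous_time[OF x] that] .
  have der: "((\<lambda>r. c x r * exp (f x * H r)) has_real_derivative 0) (at r within {0..T})" if "r \<in> {0..T}" for r
    using that by (auto intro!: derivative_eq_intros c_deriv[OF x] H simp: algebra_simps)
  obtain w where "\<forall>r\<in>{0..T}. c x r * exp (f x * H r) = w"
    using has_field_derivative_zero_constant[OF _ der] by auto
  then have "c x t * exp (f x * H t) = c x s * exp (f x * H s)" using st by auto
  moreover have "H t = H s + integral {s..t} (rate x)"
    unfolding H_def using st rate_integrable_time[OF x]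
    by (intro Henstock_Kurzweil_Integration.integral_combine[symmetric]) auto
  ultimately have "c x t * exp (f x * integral {s..t} (rate x)) * exp (f x * H s) = c x s * exp (f x * H s)"
    by (simp add: exp_add distrib_left mult_ac)
  then have "c x s = c x t * exp (f x * integral {s..t} (rate x))" by simp
  then show ?thesis by (simp add: mult.assoc exp_add[symmetric])
qed

lemma c_pos:
  assumes "x \<in> {0..L}" "t \<in> {0..T}"
  shows "c x t > 0"
  using c_exponential_formula[OF assms(1), of 0 t] assms c0_pos c_initial by simp

section \<open>Regularity in space\<close>

lemma mass_Lipschitz_space: "uniformly_regular 1 {0..T} {0..L} (\<lambda>t x. mass x t)"
proof -
  obtain C where C: "C > 0" "\<forall>x\<in>{0..L}. \<forall>t\<in>{0..T}. \<bar>c x t\<bar> \<le> C" by (rule c_bounded)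
  obtain D where D: "D > 0" "\<forall>x\<in>{0..L}. \<forall>t\<in>{0..T}. \<bar>mass x t\<bar> \<le> D" by (rule mass_bounded)
  have increment: "\<bar>mass y t - mass x t\<bar> \<le> C * \<bar>y - x\<bar>"
    if "t \<in> {0..T}" "x \<in> {0..L}" "y \<in> {0..L}" "x \<le> y" for t x y
  proof -
    have "mass y t = mass x t + integral {x..y} (\<lambda>\<xi>. c \<xi> t)"
      unfolding mass_def using that
      by (intro Henstock_Kurzweil_Integration.integral_combine[symmetric] c_integrable_subinterval) auto
    moreover have "\<bar>integral {x..y} (\<lambda>\<xi>. c \<xi> t)\<bar> \<le> C * (y - x)"
      using C that by (intro abs_integral_le c_integrable_subinterval) auto
    ultimately show ?thesis using that by simp
  qed
  have "regular 1 (max C D) {0..L} (\<lambda>x. mass x t)" if t: "t \<in> {0..T}" for t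
  proof (rule regularI)
    fix x y assume xy: "x \<in> {0..L}" "y \<in> {0..L}"
    have "\<bar>mass x t - mass y t\<bar> \<le> C * \<bar>x - y\<bar>"
      using increment[OF t xy] increment[OF t xy(2,1)] by (cases "x \<le> y") (auto simp: abs_minus_commute)
    also have "\<dots> \<le> max C D * \<bar>x - y\<bar>" by (intro mult_right_mono) auto
    finally show "\<bar>mass x t - mass y t\<bar> \<le> max C D * \<bar>x - y\<bar>" .
  qed (use D t in \<open>auto simp: le_max_iff_disj\<close>)
  then show ?thesis unfolding uniformly_regular_def by blast
qed

text \<open>The exponential formula transfers the regularity of the rate to \<open>c\<close>: no derivative of \<open>c\<close> in space is
given, but the formula contains \<open>x\<close> only through \<open>c\<^sub>0\<close>, \<open>f\<close> and the rate.\<close>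

lemma c_regular_space_if_rate:
  assumes "uniformly_regular k {0..T} {0..L} (\<lambda>t x. rate x t)"
  shows "uniformly_regular k {0..T} {0..L} (\<lambda>t x. c x t)"
proof (rule uniformly_regular_cong)
  have int: "uniformly_regular k {0..T} {0..L} (\<lambda>t x. integral {0..t} (\<lambda>s. rate x s))"
  proof (rule uniformly_regular_integral[where Q = "SIGMA t:{0..T}. {0..t}" and D = T])
    show "uniformly_regular k (SIGMA t:{0..T}. {0..t}) {0..L} (\<lambda>r x. rate x (snd r))"
      by (rule uniformly_regular_reindex[OF assms]) auto
    show "rate x integrable_on {0..t}" if "t \<in> {0..T}" "x \<in> {0..L}" for x t
      using that by (intro rate_integrable_time) auto
  qed auto
  show "uniformly_regular k {0..T} {0..L} (\<lambda>t x. c\<^sub>0 x * exp ((- 1) * (f x * integral {0..t} (\<lambda>s. rate x s))))"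
    by (intro uniformly_regular_mult uniformly_regular_exp uniformly_regular_cmult int
        c0_regular f_regular) auto
  show "c x t = c\<^sub>0 x * exp ((- 1) * (f x * integral {0..t} (\<lambda>s. rate x s)))"
    if "t \<in> {0..T}" "x \<in> {0..L}" for t x
    using c_exponential_formula[OF that(2), of 0 t] that c_initial by simp
qed auto

lemma rate_regular_space_if_mass:
  assumes "uniformly_regular k {0..T} {0..L} (\<lambda>t x. mass x t)"
  shows "uniformly_regular k {0..T} {0..L} (\<lambda>t x. rate x t)"
  using assms by (intro rate_regular[where xf = "\<lambda>t x. x" and tf = "\<lambda>t x. t"] cumulative_regular) auto

lemma c_Lipschitz_space: "uniformly_regular 1 {0..T} {0..L} (\<lambda>t x. c x t)"
  by (intro c_regular_space_if_rate rate_regular_space_if_mass mass_Lipschitz_space)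

text \<open>Continuity of \<open>c\<close> in space makes \<open>mass\<close> differentiable with derivative \<open>c\<close>, which is Lipschitz.\<close>

lemma mass_regular_space: "uniformly_regular k {0..T} {0..L} (\<lambda>t x. mass x t)"
proof -
  obtain D where D: "D > 0" "\<forall>x\<in>{0..L}. \<forall>t\<in>{0..T}. \<bar>mass x t\<bar> \<le> D" by (rule mass_bounded)
  have "((\<lambda>x. mass x t) has_real_derivative c x t) (at x within {0..L})"
    if "t \<in> {0..T}" "x \<in> {0..L}" for t x
  proof -
    have "continuous_on {0..L} (\<lambda>x. c x t)"
      using c_Lipschitz_space that unfolding uniformly_regular_def by (blast intro: regular_continuous_on)
    then show ?thesis unfolding mass_def using that(2) by (rule integral_has_real_derivative)
  qed
  then show ?thesis
    using D by (intro uniformly_regular_from_derivative[OF _ _ _ c_Lipschitz_space, where B = D]) auto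
qed

lemma c_regular_space: "uniformly_regular k {0..T} {0..L} (\<lambda>t x. c x t)"
  by (intro c_regular_space_if_rate rate_regular_space_if_mass mass_regular_space)

section \<open>Quadrature of the mass and of the reaction rate\<close>

text \<open>The trapezoidal rule is used by the corrector, the rectangle rule by the predictor. An error \<open>e\<close>
in the nodal values is amplified by the length of the interval at most.\<close>

lemma mass_quadrature_error:
  "\<exists>C\<ge>0. \<forall>dx j t v e. dx > 0 \<longrightarrow> real j * dx \<le> L \<longrightarrow> t \<in> {0..T} \<longrightarrow>
     (\<forall>i\<le>j. \<bar>v i - c (real i * dx) t\<bar> \<le> e) \<longrightarrow>
     \<bar>trapezoid dx v j - mass (real j * dx) t\<bar> \<le> C * (e + dx\<^sup>2) \<and>
     \<bar>dx * (\<Sum>i<j. v i) - mass (real j * dx) t\<bar> \<le> C * (e + dx)"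
proof -
  obtain K where K: "K \<ge> 0" "\<forall>t\<in>{0..T}. regular 2 K {0..L} (\<lambda>x. c x t)"
    using c_regular_space by (rule uniformly_regularE)
  show ?thesis
  proof (intro exI[of _ "L + K * L"] conjI allI impI)
    show "0 \<le> L + K * L" using K L_pos by simp
    fix dx e t :: real and j :: nat and v :: "nat \<Rightarrow> real"
    assume dx: "dx > 0" and j: "real j * dx \<le> L" and t: "t \<in> {0..T}"
      and v: "\<forall>i\<le>j. \<bar>v i - c (real i * dx) t\<bar> \<le> e"
    have reg: "regular 2 K {0..L} (\<lambda>x. c x t)" using K t by blast
    have e: "e \<ge> 0" using v[rule_format, of 0] by simp
    have a: "e * (real j * dx) \<le> e * L" using e j by (intro mult_left_mono) auto
    have b: "K * (real j * dx) * d \<le> K * L * d" if "d \<ge> 0" for d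
      using K j that dx by (intro mult_right_mono mult_left_mono) auto
    have pos: "0 \<le> L * dx\<^sup>2" "0 \<le> K * L * e" "0 \<le> L * dx" using L_pos K e dx by auto
    have "\<bar>trapezoid dx v j - trapezoid dx (\<lambda>i. c (real i * dx) t) j\<bar> \<le> e * (real j * dx)"
      using dx v by (intro trapezoid_diff_le) auto
    moreover have "\<bar>mass (real j * dx) t - trapezoid dx (\<lambda>i. c (real i * dx) t) j\<bar> \<le> K * (real j * dx) * dx\<^sup>2"
      using trapezoid_error[OF reg, of dx j] dx j by (simp add: mass_def)
    ultimately show "\<bar>trapezoid dx v j - mass (real j * dx) t\<bar> \<le> (L + K * L) * (e + dx\<^sup>2)"
      using a b[of "dx\<^sup>2"] pos by (simp add: algebra_simps abs_le_iff) 
    have "\<bar>dx * (\<Sum>i<j. v i) - dx * (\<Sum>i<j. c (real i * dx) t)\<bar> \<le> e * (real j * dx)"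
      using dx v by (intro rectangle_diff_le) auto
    moreover have "\<bar>mass (real j * dx) t - dx * (\<Sum>i<j. c (real i * dx) t)\<bar> \<le> K * (real j * dx) * dx"
      using rectangle_error[OF reg, of dx j] dx j by (simp add: mass_def)
    ultimately show "\<bar>dx * (\<Sum>i<j. v i) - mass (real j * dx) t\<bar> \<le> (L + K * L) * (e + dx)"
      using a b[of dx] dx pos by (simp add: algebra_simps abs_le_iff)
  qed
qed

text \<open>The bound \<open>D\<close> will be chosen to cover the numerical as well as the exact masses.\<close>

lemma R_Lipschitz_mass:
  "\<exists>K\<ge>0. \<forall>l\<in>{lam0..lam1}. \<forall>x\<in>{0..L}. \<forall>s\<in>{-D..D}. \<forall>r\<in>{-D..D}.
     \<bar>R l (cumulative c\<^sub>0 x) s - R l (cumulative c\<^sub>0 x) r\<bar> \<le> K * \<bar>s - r\<bar>"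
proof -
  obtain B where B: "\<forall>p\<in>(UNIV :: unit set). regular 1 B {0..L} (cumulative c\<^sub>0)"
    using cumulative_regular[of 1 "UNIV :: unit set"] by (rule uniformly_regularE)
  have "uniformly_regular 1 ({lam0..lam1} \<times> {0..L}) {-D..D} (\<lambda>p s. R (fst p) (cumulative c\<^sub>0 (snd p)) s)"
  proof (rule R_regular)
    show "uniformly_regular 1 ({lam0..lam1} \<times> {0..L}) {-D..D} (\<lambda>p s. fst p)"
      by (intro uniformly_regular_const[of _ _ "max \<bar>lam0\<bar> \<bar>lam1\<bar>"]) auto
    show "uniformly_regular 1 ({lam0..lam1} \<times> {0..L}) {-D..D} (\<lambda>p s. cumulative c\<^sub>0 (snd p))"
      using regular_bound[OF B[rule_format]] by (intro uniformly_regular_const[of _ _ B]) auto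
  qed (auto intro: uniformly_regular_ident)
  then obtain K where "K \<ge> 0"
    "\<forall>p\<in>{lam0..lam1} \<times> {0..L}. regular 1 K {-D..D} (\<lambda>s. R (fst p) (cumulative c\<^sub>0 (snd p)) s)"
    by (rule uniformly_regularE)
  then show ?thesis by (intro exI[of _ K]) (auto dest!: bspec intro!: regular_Lipschitz)
qed

lemma R_regular_wavelength:
  "\<exists>K\<ge>0. \<forall>x\<in>{0..L}. \<forall>t\<in>{0..T}. regular 2 K {lam0..lam1} (\<lambda>l. R l (cumulative c\<^sub>0 x) (mass x t))"
proof -
  obtain B where B: "\<forall>p\<in>(UNIV :: unit set). regular 1 B {0..L} (cumulative c\<^sub>0)"
    using cumulative_regular[of 1 "UNIV :: unit set"] by (rule uniformly_regularE)
  obtain D where D: "D > 0" "\<forall>x\<in>{0..L}. \<forall>t\<in>{0..T}. \<bar>mass x t\<bar> \<le> D" by (rule mass_bounded)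
  have "uniformly_regular 2 ({0..L} \<times> {0..T}) {lam0..lam1}
      (\<lambda>p l. R l (cumulative c\<^sub>0 (fst p)) (mass (fst p) (snd p)))"
  proof (rule R_regular)
    show "uniformly_regular 2 ({0..L} \<times> {0..T}) {lam0..lam1} (\<lambda>p l. cumulative c\<^sub>0 (fst p))"
      using regular_bound[OF B[rule_format]] by (intro uniformly_regular_const[of _ _ B]) auto
    show "uniformly_regular 2 ({0..L} \<times> {0..T}) {lam0..lam1} (\<lambda>p l. mass (fst p) (snd p))"
      using D by (intro uniformly_regular_const[of _ _ D]) auto
  qed (auto intro: uniformly_regular_ident)
  then obtain K where "K \<ge> 0" "\<forall>p\<in>{0..L} \<times> {0..T}. regular 2 K {lam0..lam1}
      (\<lambda>l. R l (cumulative c\<^sub>0 (fst p)) (mass (fst p) (snd p)))"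
    by (rule uniformly_regularE)
  then show ?thesis by (intro exI[of _ K]) auto
qed

lemma rate_quadrature_error:
  "\<exists>C\<ge>0. \<forall>dl Nl x t s e. dl > 0 \<longrightarrow> real Nl * dl = lam1 - lam0 \<longrightarrow> x \<in> {0..L} \<longrightarrow> t \<in> {0..T} \<longrightarrow>
     \<bar>s\<bar> \<le> D \<longrightarrow> \<bar>s - mass x t\<bar> \<le> e \<longrightarrow>
     \<bar>trapezoid dl (\<lambda>l. R (lam0 + real l * dl) (cumulative c\<^sub>0 x) s) Nl - rate x t\<bar> \<le> C * (e + dl\<^sup>2) \<and>
     \<bar>dl * (\<Sum>l<Nl. R (lam0 + real l * dl) (cumulative c\<^sub>0 x) s) - rate x t\<bar> \<le> C * (e + dl)"
proof -
  define W where "W = lam1 - lam0"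
  have W: "W > 0" using lam_less by (simp add: W_def)
  obtain D' where D': "D' > 0" "\<forall>x\<in>{0..L}. \<forall>t\<in>{0..T}. \<bar>mass x t\<bar> \<le> D'" by (rule mass_bounded)
  define D2 where "D2 = max D D'"
  obtain K where K: "K \<ge> 0" "\<forall>x\<in>{0..L}. \<forall>t\<in>{0..T}. regular 2 K {lam0..lam1} (\<lambda>l. R l (cumulative c\<^sub>0 x) (mass x t))"
    using R_regular_wavelength by blast
  obtain M where M: "M \<ge> 0" "\<forall>l\<in>{lam0..lam1}. \<forall>x\<in>{0..L}. \<forall>s\<in>{-D2..D2}. \<forall>r\<in>{-D2..D2}.
     \<bar>R l (cumulative c\<^sub>0 x) s - R l (cumulative c\<^sub>0 x) r\<bar> \<le> M * \<bar>s - r\<bar>"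
    using R_Lipschitz_mass[of D2] by blast
  show ?thesis
  proof (intro exI[of _ "M * W + K * W"] conjI allI impI)
    show "0 \<le> M * W + K * W" using K M W by simp
    fix dl x t s e :: real and Nl :: nat
    assume dl: "dl > 0" and Nl: "real Nl * dl = lam1 - lam0" and x: "x \<in> {0..L}" and t: "t \<in> {0..T}"
      and s: "\<bar>s\<bar> \<le> D" "\<bar>s - mass x t\<bar> \<le> e"
    define g where "g l = R l (cumulative c\<^sub>0 x) (mass x t)" for l
    have reg: "regular 2 K {lam0..lam1} g" using K x t unfolding g_def by blast
    have NlW: "real Nl * dl = W" using Nl by (simp add: W_def)
    have end': "lam0 + real Nl * dl = lam1" using Nl by simp
    have ms: "mass x t \<in> {-D2..D2}" "s \<in> {-D2..D2}"
      using D'(2)[rule_format, OF x t] s(1) unfolding D2_def by (auto simp: abs_le_iff)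
    have point: "\<bar>R (lam0 + real l * dl) (cumulative c\<^sub>0 x) s - g (lam0 + real l * dl)\<bar> \<le> M * e" if "l \<le> Nl" for l
    proof -
      have "real l * dl \<le> real Nl * dl" using that dl by (intro mult_right_mono) auto
      then have "lam0 + real l * dl \<in> {lam0..lam1}" using end' dl by auto
      then have "\<bar>R (lam0 + real l * dl) (cumulative c\<^sub>0 x) s - g (lam0 + real l * dl)\<bar> \<le> M * \<bar>s - mass x t\<bar>"
        unfolding g_def using M x ms by blast
      also have "\<dots> \<le> M * e" using M s by (intro mult_left_mono)
      finally show ?thesis .
    qed
    have pos: "0 \<le> M * W * dl\<^sup>2" "0 \<le> K * W * e" "0 \<le> M * W * dl" using W M K s dl by auto
    have rate_eq: "rate x t = integral {lam0..lam0 + real Nl * dl} g"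
      unfolding end' rate_def g_def ..
    have "\<bar>trapezoid dl (\<lambda>l. R (lam0 + real l * dl) (cumulative c\<^sub>0 x) s) Nl -
        trapezoid dl (\<lambda>l. g (lam0 + real l * dl)) Nl\<bar> \<le> M * e * W"
      using dl point unfolding NlW[symmetric] by (intro trapezoid_diff_le) auto
    moreover have "\<bar>rate x t - trapezoid dl (\<lambda>l. g (lam0 + real l * dl)) Nl\<bar> \<le> K * W * dl\<^sup>2"
      using trapezoid_error[OF reg, of dl Nl] dl end' unfolding rate_eq NlW by simp
    ultimately show "\<bar>trapezoid dl (\<lambda>l. R (lam0 + real l * dl) (cumulative c\<^sub>0 x) s) Nl - rate x t\<bar>
        \<le> (M * W + K * W) * (e + dl\<^sup>2)"
      using pos by (simp add: algebra_simps abs_le_iff)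
    have "\<bar>dl * (\<Sum>l<Nl. R (lam0 + real l * dl) (cumulative c\<^sub>0 x) s) -
        dl * (\<Sum>l<Nl. g (lam0 + real l * dl))\<bar> \<le> M * e * W"
      using dl point unfolding NlW[symmetric] by (intro rectangle_diff_le) auto
    moreover have "\<bar>rate x t - dl * (\<Sum>l<Nl. g (lam0 + real l * dl))\<bar> \<le> K * W * dl"
      using rectangle_error[OF reg, of dl Nl] dl end' unfolding rate_eq NlW by simp
    ultimately show "\<bar>dl * (\<Sum>l<Nl. R (lam0 + real l * dl) (cumulative c\<^sub>0 x) s) - rate x t\<bar>
        \<le> (M * W + K * W) * (e + dl)"
      using pos by (simp add: algebra_simps abs_le_iff)
  qed
qed

section \<open>One step of the predictor-corrector method\<close>

text \<open>The last condition is \<open>\<phi>(dt) = dt + O(dt\<^sup>2)\<close> for a single step size, with an explicit constant.\<close>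

definition step_sizes :: "(real \<Rightarrow> real) \<Rightarrow> real \<Rightarrow> real \<Rightarrow> real \<Rightarrow> real \<Rightarrow> nat \<Rightarrow> bool" where
  "step_sizes \<phi> K\<^sub>0 dx dt dl Nl \<longleftrightarrow> dx > 0 \<and> dt > 0 \<and> dl > 0 \<and> real Nl * dl = lam1 - lam0 \<and>
     \<phi> dt > 0 \<and> \<bar>\<phi> dt - dt\<bar> \<le> K\<^sub>0 * dt\<^sup>2"

text \<open>The range \<open>[0, Cm]\<close> is carried along with the error because it confines the numerical masses to a
compact interval, on which \<open>R\<close> is Lipschitz.\<close>

definition approximates :: "real \<Rightarrow> real \<Rightarrow> (nat \<Rightarrow> real) \<Rightarrow> nat \<Rightarrow> real \<Rightarrow> real \<Rightarrow> bool" where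
  "approximates Cm dx u j t e \<longleftrightarrow> (\<forall>i\<le>j. 0 \<le> u i \<and> u i \<le> Cm \<and> \<bar>u i - c (real i * dx) t\<bar> \<le> e)"

lemma wavelength_node:
  assumes "step_sizes \<phi> K\<^sub>0 dx dt dl Nl" "l \<le> Nl"
  shows "lam0 + real l * dl \<in> {lam0..lam1}"
proof -
  have "real l * dl \<le> real Nl * dl"
    using assms by (intro mult_right_mono) (auto simp: step_sizes_def)
  then show ?thesis using assms by (auto simp: step_sizes_def)
qed

lemma integral_rate_bounds:
  assumes x: "x \<in> {0..L}" and st: "0 \<le> s" "s \<le> t" "t \<le> T"
    and M: "\<forall>x\<in>{0..L}. \<forall>t\<in>{0..T}. rate x t \<le> M"
  shows "0 \<le> integral {s..t} (rate x)" "integral {s..t} (rate x) \<le> M * (t - s)"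
proof -
  show "0 \<le> integral {s..t} (rate x)"
    using st rate_nonneg by (intro integral_nonneg rate_integrable_time[OF x]) auto
  have "\<bar>integral {s..t} (rate x)\<bar> \<le> M * (t - s)"
    using st M x rate_nonneg by (intro abs_integral_le rate_integrable_time) auto
  then show "integral {s..t} (rate x) \<le> M * (t - s)" by simp
qed

text \<open>Let \<open>Q\<close> be the rectangle sum for the rate. The predictor is \<open>u / (1 + w)\<close> with \<open>w = \<phi>(dt) f Q\<close>,
and the exact value is \<open>c exp (- z)\<close> with \<open>z\<close> equal to \<open>f\<close> times the integral of the rate. Both \<open>w\<close> and
\<open>z\<close> agree with \<open>dt f G\<close> up to \<open>dt\<close> times first-order quantities, and \<open>w\<^sup>2\<close> is of order \<open>dt\<^sup>2\<close>.\<close>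

lemma predictor_error:
  assumes Cm: "\<forall>x\<in>{0..L}. c\<^sub>0 x \<le> Cm" and K0: "K\<^sub>0 \<ge> 0"
  shows "\<exists>C\<ge>0. \<forall>dx dt dl Nl t j u e. step_sizes \<phi> K\<^sub>0 dx dt dl Nl \<longrightarrow> real j * dx \<le> L \<longrightarrow>
     0 \<le> t \<longrightarrow> t + dt \<le> T \<longrightarrow> approximates Cm dx u j t e \<longrightarrow>
     \<bar>pc_predictor R f c\<^sub>0 \<phi> lam0 dx dt dl Nl u j - c (real j * dx) (t + dt)\<bar>
       \<le> C * (e + dt * (dx + dt + dl)) \<and>
     0 \<le> pc_predictor R f c\<^sub>0 \<phi> lam0 dx dt dl Nl u j \<and>
     pc_predictor R f c\<^sub>0 \<phi> lam0 dx dt dl Nl u j \<le> Cm"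
proof -
  obtain F where F: "F > 0" "\<forall>x\<in>{0..L}. \<bar>f x\<bar> \<le> F" by (rule f_bounded)
  obtain M where M: "M > 0" "\<forall>x\<in>{0..L}. \<forall>t\<in>{0..T}. rate x t \<le> M" by (rule rate_bounded)
  obtain D where D: "D > 0" "\<forall>x\<in>{0..L}. \<forall>t\<in>{0..T}. \<bar>mass x t\<bar> \<le> D" by (rule mass_bounded)
  obtain K where K: "K \<ge> 0" "\<forall>x\<in>{0..L}. regular 2 K {0..T} (rate x)"
    using rate_regular_time by (rule uniformly_regularE)
  obtain Cs where Cs: "Cs \<ge> 0" "\<And>dx j t v e. dx > 0 \<Longrightarrow> real j * dx \<le> L \<Longrightarrow> t \<in> {0..T} \<Longrightarrow>
     (\<forall>i\<le>j. \<bar>v i - c (real i * dx) t\<bar> \<le> e) \<Longrightarrow>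
     \<bar>dx * (\<Sum>i<j. v i) - mass (real j * dx) t\<bar> \<le> Cs * (e + dx)"
    using mass_quadrature_error by blast
  obtain C1 where C1: "C1 \<ge> 0" "\<And>dl Nl x t s e. dl > 0 \<Longrightarrow> real Nl * dl = lam1 - lam0 \<Longrightarrow> x \<in> {0..L} \<Longrightarrow>
     t \<in> {0..T} \<Longrightarrow> \<bar>s\<bar> \<le> Cm * L \<Longrightarrow> \<bar>s - mass x t\<bar> \<le> e \<Longrightarrow>
     \<bar>dl * (\<Sum>l<Nl. R (lam0 + real l * dl) (cumulative c\<^sub>0 x) s) - rate x t\<bar> \<le> C1 * (e + dl)"
    using rate_quadrature_error[of "Cm * L"] by blast
  define W where "W = lam1 - lam0"
  have W: "W > 0" using lam_less by (simp add: W_def)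
  have Cm0: "Cm > 0" using Cm c0_pos[of 0] L_pos by force
  \<comment> \<open>\<open>M'\<close> bounds the rate sum \<open>Q\<close>, and \<open>A1 * dt\<close> bounds \<open>w\<close>.\<close>
  define M' where "M' = M + C1 * (Cm * L + D + W)"
  \<comment> \<open>\<open>F * A0\<close> bounds the difference of the exponents; the summands of \<open>A0\<close> stem from \<open>\<phi>\<close>, the quadrature and the freezing of the rate at \<open>t\<close>.\<close>
  define A0 where "A0 = K\<^sub>0 * M' + C1 * (Cs * (T + 1) + 1) + K"
  define A1 where "A1 = (1 + K\<^sub>0 * T) * (F * M')"
  have M': "M' > 0" unfolding M'_def using M(1) C1(1) Cm0 L_pos D(1) W by (simp add: add_pos_nonneg)
  have A: "A0 \<ge> 0" "A1 \<ge> 0" unfolding A0_def A1_def using K0 M' C1(1) Cs(1) K(1) F(1) T_pos by auto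
  show ?thesis
  proof (intro exI[of _ "1 + Cm * (F * A0 + A1\<^sup>2)"] conjI[of "_ \<le> _"] allI impI)
    show "0 \<le> 1 + Cm * (F * A0 + A1\<^sup>2)" using Cm0 F(1) A by auto
    fix dx dt dl t e :: real and Nl j :: nat and u :: "nat \<Rightarrow> real"
    assume steps: "step_sizes \<phi> K\<^sub>0 dx dt dl Nl" and j: "real j * dx \<le> L" and t: "0 \<le> t" "t + dt \<le> T"
      and u: "approximates Cm dx u j t e"
    have d: "dx > 0" "dt > 0" "dl > 0" "real Nl * dl = lam1 - lam0" "\<phi> dt > 0" "\<bar>\<phi> dt - dt\<bar> \<le> K\<^sub>0 * dt\<^sup>2"
      using steps by (auto simp: step_sizes_def)
    have u': "0 \<le> u i" "u i \<le> Cm" "\<bar>u i - c (real i * dx) t\<bar> \<le> e" if "i \<le> j" for i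
      using u that by (auto simp: approximates_def)
    have e: "e \<ge> 0" using u'(3)[of 0] by simp
    define x where "x = real j * dx"
    have x: "x \<in> {0..L}" unfolding x_def using j d by auto
    have tT: "t \<in> {0..T}" using t d by auto
    define s where "s = dx * (\<Sum>i<j. u i)"
    define Q where "Q = dl * (\<Sum>l<Nl. R (lam0 + real l * dl) (cumulative c\<^sub>0 x) s)"
    define w where "w = \<phi> dt * (f x * Q)"
    define J where "J = integral {t..t + dt} (rate x)"
    define z where "z = f x * J"
    define E where "E = e + dt * (dx + dt + dl)"
    have pred: "pc_predictor R f c\<^sub>0 \<phi> lam0 dx dt dl Nl u j = u j * inverse (1 + w)"
      unfolding pc_predictor_def w_def Q_def s_def x_def atLeast0LessThan by (simp add: mult_ac)
    have exact: "c x (t + dt) = c x t * exp (- z)"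
      unfolding z_def J_def using x t d by (intro c_exponential_formula) auto
    have f0: "0 \<le> f x" "f x \<le> F" using f_nonneg[OF x] F(2)[rule_format, OF x] by auto
    have s_bd: "\<bar>s\<bar> \<le> Cm * L"
    proof -
      have "\<bar>s - dx * (\<Sum>i<j. 0)\<bar> \<le> Cm * (real j * dx)"
        unfolding s_def using u' d by (intro rectangle_diff_le) auto
      also have "\<dots> \<le> Cm * L" using Cm0 j by (intro mult_left_mono) auto
      finally show ?thesis by simp
    qed
    have Q0: "Q \<ge> 0"
      unfolding Q_def using d by (intro mult_nonneg_nonneg sum_nonneg R_nonneg wavelength_node[OF steps]) auto
    have "Nl \<noteq> 0"
    proof
      assume "Nl = 0"
      then show False using d(4) lam_less by simp
    qed
    then have "1 * dl \<le> real Nl * dl" using d by (intro mult_right_mono) auto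
    then have dlW: "dl \<le> W" using d by (simp add: W_def)
    have Qrate: "\<bar>Q - rate x t\<bar> \<le> C1 * (Cs * (e + dx) + dl)"
      unfolding Q_def using d x tT s_bd u' j Cs(2)[of dx j t u e] by (intro C1(2)) (auto simp: s_def x_def)
    have Q1: "Q \<le> M'"
    proof -
      have "\<bar>s - mass x t\<bar> \<le> Cm * L + D" using s_bd D(2)[rule_format, OF x tT] by linarith
      then have "\<bar>Q - rate x t\<bar> \<le> C1 * (Cm * L + D + dl)"
        unfolding Q_def using d x tT s_bd by (intro C1(2)) auto
      also have "\<dots> \<le> C1 * (Cm * L + D + W)" using C1(1) dlW by (intro mult_left_mono) auto
      finally show ?thesis using M(2)[rule_format, OF x tT] unfolding M'_def by linarith
    qed
    have prods: "0 \<le> dt * dx" "0 \<le> dt * dt" "0 \<le> dt * dl" "dt * e \<le> T * e" "0 \<le> dt * e"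
      using d e t by (auto intro: mult_right_mono)
    then have E: "e \<le> E" "dt\<^sup>2 \<le> E" "dt * dx \<le> E" "dt * dl \<le> E" "0 \<le> E"
      unfolding E_def power2_eq_square using e by (auto simp: distrib_left)
    have "T * e \<le> T * E" using E T_pos by (intro mult_left_mono) auto
    then have E': "dt * (e + dx) \<le> (T + 1) * E"
      using prods E by (simp add: distrib_left distrib_right)
    have J: "0 \<le> J" and JE: "\<bar>J - dt * rate x t\<bar> \<le> K * E"
    proof -
      show "0 \<le> J" unfolding J_def using x t d M by (intro integral_rate_bounds) auto
      have "\<bar>J - dt * rate x t\<bar> \<le> K * dt\<^sup>2"
        using rectangle_panel_error[OF K(2)[rule_format, OF x], of t "t + dt"] t d by (simp add: J_def)
      also have "\<dots> \<le> K * E" using K E by (intro mult_left_mono)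
      finally show "\<bar>J - dt * rate x t\<bar> \<le> K * E" .
    qed
    \<comment> \<open>the three contributions to the difference of the exponents, beginning with that of \<open>\<phi>\<close>\<close>
    have T1: "\<bar>(\<phi> dt - dt) * Q\<bar> \<le> K\<^sub>0 * M' * E"
    proof -
      have "\<bar>\<phi> dt - dt\<bar> * \<bar>Q\<bar> \<le> (K\<^sub>0 * dt\<^sup>2) * M'"
        using d Q0 Q1 K0 by (intro mult_mono) auto
      also have "\<dots> = (K\<^sub>0 * M') * dt\<^sup>2" by simp
      also have "\<dots> \<le> K\<^sub>0 * M' * E" using K0 M' E by (intro mult_left_mono) auto
      finally show ?thesis by (simp add: abs_mult)
    qed
    have T2: "\<bar>dt * (Q - rate x t)\<bar> \<le> C1 * (Cs * (T + 1) + 1) * E"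
    proof -
      have "\<bar>dt * (Q - rate x t)\<bar> \<le> dt * (C1 * (Cs * (e + dx) + dl))"
        unfolding abs_mult using Qrate d by (auto intro: mult_left_mono)
      also have "\<dots> = C1 * (Cs * (dt * (e + dx)) + dt * dl)" by (simp add: algebra_simps)
      also have "\<dots> \<le> C1 * (Cs * ((T + 1) * E) + E)"
        using C1(1) Cs(1) E' E by (intro mult_left_mono add_mono) auto
      finally show ?thesis by (simp add: algebra_simps)
    qed
    have "\<phi> dt * Q - J = (\<phi> dt - dt) * Q + dt * (Q - rate x t) - (J - dt * rate x t)"
      by (simp add: algebra_simps)
    then have "\<bar>\<phi> dt * Q - J\<bar> \<le> A0 * E"
      using T1 T2 JE unfolding A0_def distrib_right by linarith
    then have "f x * \<bar>\<phi> dt * Q - J\<bar> \<le> F * (A0 * E)"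
      using f0 F(1) by (intro mult_mono) auto
    moreover have "w - z = f x * (\<phi> dt * Q - J)" unfolding w_def z_def by (simp add: algebra_simps)
    ultimately have wz: "\<bar>w - z\<bar> \<le> F * A0 * E" using f0 by (simp add: abs_mult mult.assoc)
    have w0: "w \<ge> 0" unfolding w_def using d f0 Q0 by auto
    have z0: "z \<ge> 0" unfolding z_def using f0 J by auto
    have w2: "w\<^sup>2 \<le> A1\<^sup>2 * E"
    proof -
      have "K\<^sub>0 * dt * dt \<le> K\<^sub>0 * T * dt" using K0 d t by (intro mult_right_mono mult_left_mono) auto
      then have "\<phi> dt \<le> (1 + K\<^sub>0 * T) * dt"
        using d(6) by (simp add: algebra_simps power2_eq_square)
      moreover have "f x * Q \<le> F * M'" using f0 Q0 Q1 F(1) by (intro mult_mono) auto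
      ultimately have "w \<le> ((1 + K\<^sub>0 * T) * dt) * (F * M')"
        unfolding w_def by (rule mult_mono) (use d f0 Q0 K0 T_pos in auto)
      then have "w \<le> A1 * dt" by (simp add: A1_def mult_ac)
      then have "w\<^sup>2 \<le> (A1 * dt)\<^sup>2" using w0 by (intro power_mono)
      also have "\<dots> = A1\<^sup>2 * dt\<^sup>2" by (simp add: power_mult_distrib)
      also have "\<dots> \<le> A1\<^sup>2 * E" using E by (intro mult_left_mono) auto
      finally show ?thesis .
    qed
    have inv: "0 \<le> inverse (1 + w)" "inverse (1 + w) \<le> 1" using w0 by (auto simp: field_simps)
    have V: "0 \<le> c x t" "c x t \<le> Cm"
      using c_pos[OF x tT] c_abs_le_initial[OF x tT] Cm[rule_format, OF x] by auto
    have "\<bar>inverse (1 + w) - exp (- z)\<bar> \<le> F * A0 * E + A1\<^sup>2 * E"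
      using implicit_Euler_factor_error[OF w0 z0] wz w2 by linarith
    then have b: "\<bar>c x t * (inverse (1 + w) - exp (- z))\<bar> \<le> Cm * (F * A0 * E + A1\<^sup>2 * E)"
      unfolding abs_mult using V by (intro mult_mono) auto
    have "\<bar>(u j - c x t) * inverse (1 + w)\<bar> \<le> e * 1"
      unfolding abs_mult using inv u'(3)[of j] e by (intro mult_mono) (auto simp: x_def)
    moreover have "u j * inverse (1 + w) - c x t * exp (- z) =
        (u j - c x t) * inverse (1 + w) + c x t * (inverse (1 + w) - exp (- z))"
      by (simp add: algebra_simps)
    ultimately have "\<bar>u j * inverse (1 + w) - c x t * exp (- z)\<bar> \<le> E + Cm * (F * A0 * E + A1\<^sup>2 * E)"
      using b E by linarith
    then show "\<bar>pc_predictor R f c\<^sub>0 \<phi> lam0 dx dt dl Nl u j - c (real j * dx) (t + dt)\<bar>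
        \<le> (1 + Cm * (F * A0 + A1\<^sup>2)) * (e + dt * (dx + dt + dl))"
      unfolding pred x_def[symmetric] exact E_def[symmetric] by (simp add: algebra_simps)
    show "0 \<le> pc_predictor R f c\<^sub>0 \<phi> lam0 dx dt dl Nl u j"
      unfolding pred using inv u' by simp
    have "u j * inverse (1 + w) \<le> Cm * 1" using inv u'[of j] Cm0 by (intro mult_mono) auto
    then show "pc_predictor R f c\<^sub>0 \<phi> lam0 dx dt dl Nl u j \<le> Cm" unfolding pred by simp
  qed
qed

text \<open>The exponents of the corrector and of the exact solution differ by the error of the trapezoidal rules in
time, space and wavelength and by the errors of \<open>u\<close> and of the predictor. Each of these enters with a
factor \<open>dt\<close>, so that the first-order predictor contributes \<open>dt (e + dt (dx + dt + dl))\<close>.\<close>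

lemma corrector_error:
  assumes Cm: "\<forall>x\<in>{0..L}. c\<^sub>0 x \<le> Cm" and K0: "K\<^sub>0 \<ge> 0"
  shows "\<exists>C\<ge>0. \<forall>dx dt dl Nl t j u e. step_sizes \<phi> K\<^sub>0 dx dt dl Nl \<longrightarrow> real j * dx \<le> L \<longrightarrow>
     0 \<le> t \<longrightarrow> t + dt \<le> T \<longrightarrow> approximates Cm dx u j t e \<longrightarrow>
     \<bar>pc_step R f c\<^sub>0 \<phi> lam0 dx dt dl Nl u j - c (real j * dx) (t + dt)\<bar>
       \<le> e + C * dt * (e + (dx + dt + dl)\<^sup>2) \<and>
     0 \<le> pc_step R f c\<^sub>0 \<phi> lam0 dx dt dl Nl u j \<and>
     pc_step R f c\<^sub>0 \<phi> lam0 dx dt dl Nl u j \<le> Cm"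
proof -
  obtain F where F: "F > 0" "\<forall>x\<in>{0..L}. \<bar>f x\<bar> \<le> F" by (rule f_bounded)
  obtain M where M: "M > 0" "\<forall>x\<in>{0..L}. \<forall>t\<in>{0..T}. rate x t \<le> M" by (rule rate_bounded)
  obtain K where K: "K \<ge> 0" "\<forall>x\<in>{0..L}. regular 2 K {0..T} (rate x)"
    using rate_regular_time by (rule uniformly_regularE)
  obtain Cp where Cp: "Cp \<ge> 0" "\<And>dx dt dl Nl t j u e. step_sizes \<phi> K\<^sub>0 dx dt dl Nl \<Longrightarrow> real j * dx \<le> L \<Longrightarrow>
     0 \<le> t \<Longrightarrow> t + dt \<le> T \<Longrightarrow> approximates Cm dx u j t e \<Longrightarrow>
     \<bar>pc_predictor R f c\<^sub>0 \<phi> lam0 dx dt dl Nl u j - c (real j * dx) (t + dt)\<bar>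
       \<le> Cp * (e + dt * (dx + dt + dl)) \<and>
     0 \<le> pc_predictor R f c\<^sub>0 \<phi> lam0 dx dt dl Nl u j \<and>
     pc_predictor R f c\<^sub>0 \<phi> lam0 dx dt dl Nl u j \<le> Cm"
    using predictor_error[OF assms, of \<phi>] by blast
  obtain Cs where Cs: "Cs \<ge> 0" "\<And>dx j t v e. dx > 0 \<Longrightarrow> real j * dx \<le> L \<Longrightarrow> t \<in> {0..T} \<Longrightarrow>
     (\<forall>i\<le>j. \<bar>v i - c (real i * dx) t\<bar> \<le> e) \<Longrightarrow>
     \<bar>trapezoid dx v j - mass (real j * dx) t\<bar> \<le> Cs * (e + dx\<^sup>2)"
    using mass_quadrature_error by blast
  obtain C1 where C1: "C1 \<ge> 0" "\<And>dl Nl x t s e. dl > 0 \<Longrightarrow> real Nl * dl = lam1 - lam0 \<Longrightarrow> x \<in> {0..L} \<Longrightarrow>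
     t \<in> {0..T} \<Longrightarrow> \<bar>s\<bar> \<le> Cm * L \<Longrightarrow> \<bar>s - mass x t\<bar> \<le> e \<Longrightarrow>
     \<bar>trapezoid dl (\<lambda>l. R (lam0 + real l * dl) (cumulative c\<^sub>0 x) s) Nl - rate x t\<bar> \<le> C1 * (e + dl\<^sup>2)"
    using rate_quadrature_error[of "Cm * L"] by blast
  have Cm0: "Cm > 0" using Cm c0_pos[of 0] L_pos by force
  \<comment> \<open>The summands of \<open>A\<close> stem from the time quadrature and from the rates at \<open>u\<close> and at the predictor.\<close>
  define A where "A = K + C1 * (Cs + 1) + C1 * (Cs * (Cp + 1) + 1)"
  have A: "A \<ge> 0" unfolding A_def using K(1) C1(1) Cs(1) Cp(1) by auto
  show ?thesis
  proof (intro exI[of _ "Cm * (F * A)"] conjI[of "_ \<le> _"] allI impI)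
    show "0 \<le> Cm * (F * A)" using Cm0 F(1) A by auto
    fix dx dt dl t e :: real and Nl j :: nat and u :: "nat \<Rightarrow> real"
    assume steps: "step_sizes \<phi> K\<^sub>0 dx dt dl Nl" and j: "real j * dx \<le> L" and t: "0 \<le> t" "t + dt \<le> T"
      and u: "approximates Cm dx u j t e"
    have d: "dx > 0" "dt > 0" "dl > 0" "real Nl * dl = lam1 - lam0"
      using steps by (auto simp: step_sizes_def)
    have u': "0 \<le> u i" "u i \<le> Cm" "\<bar>u i - c (real i * dx) t\<bar> \<le> e" if "i \<le> j" for i
      using u that by (auto simp: approximates_def)
    have e: "e \<ge> 0" using u'(3)[of 0] by simp
    define x where "x = real j * dx"
    have x: "x \<in> {0..L}" unfolding x_def using j d by auto
    have tT: "t \<in> {0..T}" "t + dt \<in> {0..T}" using t d by auto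
    define p where "p = pc_predictor R f c\<^sub>0 \<phi> lam0 dx dt dl Nl u"
    \<comment> \<open>\<open>G u\<close> and \<open>G p\<close> approximate the rate at \<open>t\<close> and at \<open>t + dt\<close>.\<close>
    define G where "G v = trapezoid dl (\<lambda>l. R (lam0 + real l * dl) (cumulative c\<^sub>0 x) (trapezoid dx v j)) Nl" for v
    define w where "w = f x * (dt / 2 * (G u + G p))"
    define J where "J = integral {t..t + dt} (rate x)"
    define z where "z = f x * J"
    define H where "H = e + (dx + dt + dl)\<^sup>2"
    have step: "pc_step R f c\<^sub>0 \<phi> lam0 dx dt dl Nl u j = u j * exp (- w)"
      unfolding pc_step_def Let_def w_def G_def p_def x_def pc_rate_def trapezoid_add by (simp add: mult_ac)
    have exact: "c x (t + dt) = c x t * exp (- z)"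
      unfolding z_def J_def using x t d by (intro c_exponential_formula) auto
    have f0: "0 \<le> f x" "f x \<le> F" using f_nonneg[OF x] F(2)[rule_format, OF x] by auto
    have sq: "dx\<^sup>2 \<le> (dx + dt + dl)\<^sup>2" "dt\<^sup>2 \<le> (dx + dt + dl)\<^sup>2" "dl\<^sup>2 \<le> (dx + dt + dl)\<^sup>2"
      using d by (auto intro!: power_mono)
    have "dt * (dx + dt + dl) \<le> (dx + dt + dl)\<^sup>2"
      unfolding power2_eq_square using d by (intro mult_right_mono) auto
    then have H: "0 \<le> H" "e + dt * (dx + dt + dl) \<le> H" "e + dx\<^sup>2 \<le> H" "dx\<^sup>2 \<le> H" "dl\<^sup>2 \<le> H" "dt\<^sup>2 \<le> H"
      unfolding H_def using e sq by auto
    have p: "\<bar>p i - c (real i * dx) (t + dt)\<bar> \<le> Cp * H" "0 \<le> p i" "p i \<le> Cm" if i: "i \<le> j" for i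
    proof -
      have "real i * dx \<le> real j * dx" using i d by (intro mult_right_mono) auto
      then have "real i * dx \<le> L" using j by simp
      moreover have "approximates Cm dx u i t e" using u i by (simp add: approximates_def)
      ultimately have "\<bar>p i - c (real i * dx) (t + dt)\<bar> \<le> Cp * (e + dt * (dx + dt + dl)) \<and> 0 \<le> p i \<and> p i \<le> Cm"
        unfolding p_def using steps t by (intro Cp(2))
      moreover have "Cp * (e + dt * (dx + dt + dl)) \<le> Cp * H" using Cp(1) H by (intro mult_left_mono)
      ultimately show "\<bar>p i - c (real i * dx) (t + dt)\<bar> \<le> Cp * H" "0 \<le> p i" "p i \<le> Cm" by auto
    qed
    have trap_bd: "\<bar>trapezoid dx v j\<bar> \<le> Cm * L" if "\<And>i. i \<le> j \<Longrightarrow> 0 \<le> v i" "\<And>i. i \<le> j \<Longrightarrow> v i \<le> Cm" for v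
    proof -
      have "0 \<le> trapezoid dx v j" "trapezoid dx v j \<le> Cm * (real j * dx)"
        using trapezoid_bounds[of dx j 0 v Cm] that d by auto
      moreover have "Cm * (real j * dx) \<le> Cm * L" using Cm0 j by (intro mult_left_mono) auto
      ultimately show ?thesis by simp
    qed
    have G0: "0 \<le> G v" for v
      unfolding G_def using d by (intro trapezoid_nonneg R_nonneg wavelength_node[OF steps]) auto
    have Gu: "\<bar>G u - rate x t\<bar> \<le> C1 * (Cs + 1) * H"
    proof -
      have "\<bar>G u - rate x t\<bar> \<le> C1 * (Cs * (e + dx\<^sup>2) + dl\<^sup>2)"
        unfolding G_def using d x tT trap_bd[of u] u' j Cs(2)[of dx j t u e]
        by (intro C1(2)) (auto simp: x_def)
      also have "\<dots> \<le> C1 * (Cs * H + H)" using C1(1) Cs(1) H by (intro mult_left_mono add_mono)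
      finally show ?thesis by (simp add: algebra_simps)
    qed
    have Gp: "\<bar>G p - rate x (t + dt)\<bar> \<le> C1 * (Cs * (Cp + 1) + 1) * H"
    proof -
      have "\<bar>G p - rate x (t + dt)\<bar> \<le> C1 * (Cs * (Cp * H + dx\<^sup>2) + dl\<^sup>2)"
        unfolding G_def using d x tT trap_bd[of p] p j Cs(2)[of dx j "t + dt" p "Cp * H"]
        by (intro C1(2)) (auto simp: x_def)
      also have "\<dots> \<le> C1 * (Cs * (Cp * H + H) + H)" using C1(1) Cs(1) H by (intro mult_left_mono add_mono order_refl)
      finally show ?thesis by (simp add: algebra_simps)
    qed
    have "\<bar>J - dt / 2 * (rate x t + rate x (t + dt))\<bar> \<le> K * dt ^ 3"
      using trapezoid_panel_error[OF K(2)[rule_format, OF x], of t "t + dt"] t d by (simp add: J_def)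
    also have "\<dots> = (K * dt) * dt\<^sup>2" by (simp add: power2_eq_square power3_eq_cube)
    also have "\<dots> \<le> (K * dt) * H" using K d H by (intro mult_left_mono) auto
    finally have JH: "\<bar>J - dt / 2 * (rate x t + rate x (t + dt))\<bar> \<le> dt * (K * H)" by (simp add: mult_ac)
    have "\<bar>G u + G p - (rate x t + rate x (t + dt))\<bar> \<le> (C1 * (Cs + 1) + C1 * (Cs * (Cp + 1) + 1)) * H"
      using Gu Gp unfolding distrib_right by linarith
    then have "dt / 2 * \<bar>G u + G p - (rate x t + rate x (t + dt))\<bar> \<le>
        dt * ((C1 * (Cs + 1) + C1 * (Cs * (Cp + 1) + 1)) * H)"
      using d by (intro mult_mono) auto
    then have "\<bar>dt / 2 * (G u + G p) - dt / 2 * (rate x t + rate x (t + dt))\<bar> \<le>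
        dt * ((C1 * (Cs + 1) + C1 * (Cs * (Cp + 1) + 1)) * H)"
      using d unfolding right_diff_distrib[symmetric] abs_mult by simp
    moreover have "dt * (A * H) = dt * (K * H) + dt * ((C1 * (Cs + 1) + C1 * (Cs * (Cp + 1) + 1)) * H)"
      unfolding A_def by (simp add: algebra_simps)
    ultimately have "\<bar>dt / 2 * (G u + G p) - J\<bar> \<le> dt * (A * H)"
      using JH by linarith
    then have "f x * \<bar>dt / 2 * (G u + G p) - J\<bar> \<le> F * (dt * (A * H))"
      using f0 F(1) by (intro mult_mono) auto
    moreover have "w - z = f x * (dt / 2 * (G u + G p) - J)" unfolding w_def z_def by (simp add: algebra_simps)
    ultimately have wz: "\<bar>w - z\<bar> \<le> F * (dt * (A * H))" using f0 by (simp only: abs_mult abs_of_nonneg)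
    have w0: "w \<ge> 0" unfolding w_def using d f0 G0 by auto
    have "0 \<le> J" unfolding J_def using x t d M by (intro integral_rate_bounds) auto
    then have z0: "z \<ge> 0" unfolding z_def using f0 by auto
    have V: "0 \<le> c x t" "c x t \<le> Cm"
      using c_pos[OF x tT(1)] c_abs_le_initial[OF x tT(1)] Cm[rule_format, OF x] by auto
    have "\<bar>exp (- w) - exp (- z)\<bar> \<le> F * (dt * (A * H))"
      using exp_minus_Lipschitz[OF w0 z0] wz by linarith
    then have b: "\<bar>c x t * (exp (- w) - exp (- z))\<bar> \<le> Cm * (F * (dt * (A * H)))"
      unfolding abs_mult using V by (intro mult_mono) auto
    have w1: "exp (- w) \<le> 1" using w0 by simp
    have "\<bar>(u j - c x t) * exp (- w)\<bar> \<le> e * 1"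
      unfolding abs_mult using w1 u'(3)[of j] e by (intro mult_mono) (auto simp: x_def)
    moreover have "u j * exp (- w) - c x t * exp (- z) =
        (u j - c x t) * exp (- w) + c x t * (exp (- w) - exp (- z))"
      by (simp add: algebra_simps)
    ultimately have "\<bar>u j * exp (- w) - c x t * exp (- z)\<bar> \<le> e + Cm * (F * (dt * (A * H)))"
      using b by linarith
    then show "\<bar>pc_step R f c\<^sub>0 \<phi> lam0 dx dt dl Nl u j - c (real j * dx) (t + dt)\<bar>
        \<le> e + Cm * (F * A) * dt * (e + (dx + dt + dl)\<^sup>2)"
      unfolding step x_def[symmetric] exact H_def[symmetric] by (simp add: mult_ac)
    show "0 \<le> pc_step R f c\<^sub>0 \<phi> lam0 dx dt dl Nl u j"
      unfolding step using u' by simp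
    have "u j * exp (- w) \<le> Cm * 1" using w1 u'[of j] Cm0 by (intro mult_mono) auto
    then show "pc_step R f c\<^sub>0 \<phi> lam0 dx dt dl Nl u j \<le> Cm" unfolding step by simp
  qed
qed

section \<open>Accumulation of the error\<close>

text \<open>Iterating the estimate \<open>e \<mapsto> e + C dt (e + h\<^sup>2)\<close> for \<open>n \<le> T / dt\<close> steps from an exact start gives
at most \<open>T C exp (T C) h\<^sup>2\<close>.\<close>

lemma global_error:
  assumes K0: "K\<^sub>0 \<ge> 0"
  shows "\<exists>\<kappa>\<ge>0. \<forall>dx dt dl Nx Nt Nl. step_sizes \<phi> K\<^sub>0 dx dt dl Nl \<longrightarrow> real Nx * dx = L \<longrightarrow> real Nt * dt = T \<longrightarrow>
     (\<forall>n\<le>Nt. \<forall>j\<le>Nx. \<bar>c (real j * dx) (real n * dt) - pc_scheme R f c\<^sub>0 \<phi> lam0 dx dt dl Nl n j\<bar>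
        \<le> \<kappa> * (dx + dt + dl)\<^sup>2)"
proof -
  obtain Cm where Cm: "Cm > 0" "\<forall>x\<in>{0..L}. c\<^sub>0 x \<le> Cm" by (rule c0_bounded)
  obtain C where C: "C \<ge> 0" "\<And>dx dt dl Nl t j u e. step_sizes \<phi> K\<^sub>0 dx dt dl Nl \<Longrightarrow> real j * dx \<le> L \<Longrightarrow>
     0 \<le> t \<Longrightarrow> t + dt \<le> T \<Longrightarrow> approximates Cm dx u j t e \<Longrightarrow>
     \<bar>pc_step R f c\<^sub>0 \<phi> lam0 dx dt dl Nl u j - c (real j * dx) (t + dt)\<bar>
       \<le> e + C * dt * (e + (dx + dt + dl)\<^sup>2) \<and>
     0 \<le> pc_step R f c\<^sub>0 \<phi> lam0 dx dt dl Nl u j \<and>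
     pc_step R f c\<^sub>0 \<phi> lam0 dx dt dl Nl u j \<le> Cm"
    using corrector_error[OF Cm(2) K0, of \<phi>] by blast
  show ?thesis
  proof (intro exI[of _ "T * C * exp (T * C)"] conjI allI impI)
    show "0 \<le> T * C * exp (T * C)" using T_pos C(1) by simp
    fix dx dt dl :: real and Nx Nt Nl n j :: nat
    assume steps: "step_sizes \<phi> K\<^sub>0 dx dt dl Nl" and Nx: "real Nx * dx = L" and Nt: "real Nt * dt = T"
      and n: "n \<le> Nt" and j: "j \<le> Nx"
    have d: "dx > 0" "dt > 0" using steps by (auto simp: step_sizes_def)
    have node: "0 \<le> real i * dx" "real i * dx \<le> L" if "i \<le> Nx" for i
      unfolding Nx[symmetric] using d that by (auto intro!: mult_right_mono)
    have time: "real m * dt \<le> T" if "m \<le> Nt" for m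
      unfolding Nt[symmetric] using d that by (auto intro!: mult_right_mono)
    define h2 where "h2 = (dx + dt + dl)\<^sup>2"
    \<comment> \<open>the error bound after each step, as produced by the one-step estimate\<close>
    define E where "E = rec_nat 0 (\<lambda>_ e. e + C * dt * (e + h2))"
    have E: "E 0 = 0" "E (Suc m) = E m + C * dt * (E m + h2)" for m
      by (simp_all add: E_def)
    have approx: "approximates Cm dx (pc_scheme R f c\<^sub>0 \<phi> lam0 dx dt dl Nl m) Nx (real m * dt) (E m)"
      if "m \<le> Nt" for m
      using that
    proof (induction m)
      case 0
      show ?case unfolding approximates_def using node Cm(2) c0_pos c_initial
        by (auto simp: E less_imp_le)
    next
      case (Suc m)
      have t: "real m * dt + dt = real (Suc m) * dt" "real m * dt + dt \<le> T"
        using time[OF Suc.prems] by (simp_all add: algebra_simps)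
      have IH: "approximates Cm dx (pc_scheme R f c\<^sub>0 \<phi> lam0 dx dt dl Nl m) Nx (real m * dt) (E m)"
        using Suc by simp
      show ?case
        unfolding approximates_def
      proof (intro allI impI)
        fix i assume i: "i \<le> Nx"
        have "approximates Cm dx (pc_scheme R f c\<^sub>0 \<phi> lam0 dx dt dl Nl m) i (real m * dt) (E m)"
          using IH i by (simp add: approximates_def)
        then show "0 \<le> pc_scheme R f c\<^sub>0 \<phi> lam0 dx dt dl Nl (Suc m) i \<and>
            pc_scheme R f c\<^sub>0 \<phi> lam0 dx dt dl Nl (Suc m) i \<le> Cm \<and>
            \<bar>pc_scheme R f c\<^sub>0 \<phi> lam0 dx dt dl Nl (Suc m) i - c (real i * dx) (real (Suc m) * dt)\<bar> \<le> E (Suc m)"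
          using C(2)[OF steps node(2)[OF i] _ t(2)] d unfolding t(1) E pc_scheme.simps h2_def by simp
      qed
    qed
    have "E n \<le> real n * (C * dt * h2) * exp (real n * (C * dt))"
      using C(1) d n by (intro discrete_Gronwall[where N = Nt]) (auto simp: E h2_def algebra_simps)
    also have "\<dots> = (real n * dt) * C * h2 * exp ((real n * dt) * C)" by (simp add: mult_ac)
    also have "\<dots> \<le> T * C * h2 * exp (T * C)"
      using time[OF n] C(1) T_pos d unfolding h2_def
      by (intro mult_mono) (auto intro: mult_right_mono)
    finally have "E n \<le> T * C * exp (T * C) * h2" by (simp add: mult_ac)
    then show "\<bar>c (real j * dx) (real n * dt) - pc_scheme R f c\<^sub>0 \<phi> lam0 dx dt dl Nl n j\<bar>
        \<le> T * C * exp (T * C) * (dx + dt + dl)\<^sup>2"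
      using approx[OF n] j unfolding approximates_def h2_def by (force simp: abs_minus_commute)
  qed
qed

end

section \<open>Convergence of order two\<close>

text \<open>The Landau symbol controls \<open>\<phi>\<close> for small steps only. Among the step sizes \<open>T / n\<close> just finitely many
are not small, and their quotients are absorbed in the constant. Thus the error bound holds from the
coarsest grid on.\<close>

lemma quadratic_remainder_on_grid:
  fixes \<phi> :: "real \<Rightarrow> real"
  assumes "(\<lambda>s. \<phi> s - s) \<in> O[at_right 0](\<lambda>s. s\<^sup>2)" and "T > 0"
  shows "\<exists>K\<ge>0. \<forall>n\<ge>1. \<bar>\<phi> (T / real n) - T / real n\<bar> \<le> K * (T / real n)\<^sup>2"
proof -
  define a where "a n = \<bar>\<phi> (T / real n) - T / real n\<bar> / (T / real n)\<^sup>2" for n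
  obtain k where k: "eventually (\<lambda>s. \<bar>\<phi> s - s\<bar> \<le> k * s\<^sup>2) (at_right 0)"
    using landau_o.bigE[OF assms(1)] by auto
  have "filterlim (\<lambda>n. T / real n) (at_right 0) sequentially"
    unfolding filterlim_at
  proof
    show "\<forall>\<^sub>F n in sequentially. T / real n \<in> {0<..} \<and> T / real n \<noteq> 0"
      using eventually_gt_at_top[of 0] by eventually_elim (use assms(2) in simp)
  qed (rule lim_const_over_n)
  from eventually_compose_filterlim[OF k this]
  obtain N where N: "\<And>n. n \<ge> N \<Longrightarrow> \<bar>\<phi> (T / real n) - T / real n\<bar> \<le> k * (T / real n)\<^sup>2"
    by (auto simp: eventually_sequentially)
  have a0: "a n \<ge> 0" for n by (simp add: a_def)
  have "\<bar>\<phi> (T / real n) - T / real n\<bar> \<le> (\<bar>k\<bar> + (\<Sum>i<N. a i)) * (T / real n)\<^sup>2" if n: "n \<ge> 1" for n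
  proof (cases "n < N")
    case True
    then have "a n \<le> \<bar>k\<bar> + (\<Sum>i<N. a i)" using member_le_sum[of n "{..<N}" a] a0 by force
    then have "a n * (T / real n)\<^sup>2 \<le> (\<bar>k\<bar> + (\<Sum>i<N. a i)) * (T / real n)\<^sup>2"
      by (rule mult_right_mono) simp
    moreover have "T / real n \<noteq> 0" using n assms(2) by simp
    ultimately show ?thesis by (simp add: a_def del: power_divide)
  next
    case False
    then have "\<bar>\<phi> (T / real n) - T / real n\<bar> \<le> k * (T / real n)\<^sup>2" using N by simp
    also have "\<dots> \<le> (\<bar>k\<bar> + (\<Sum>i<N. a i)) * (T / real n)\<^sup>2"
      using sum_nonneg[of "{..<N}" a] a0 by (intro mult_right_mono) auto
    finally show ?thesis .
  qed
  moreover have "0 \<le> \<bar>k\<bar> + (\<Sum>i<N. a i)" using a0 by (simp add: sum_nonneg)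
  ultimately show ?thesis by blast
qed

lemma convergent_of_orderI:
  fixes err h :: "nat \<times> nat \<times> nat \<Rightarrow> real"
  assumes bound: "\<And>Nx Nt Nl. Nx \<ge> 1 \<Longrightarrow> Nt \<ge> 1 \<Longrightarrow> Nl \<ge> 1 \<Longrightarrow> err (Nx, Nt, Nl) \<le> \<kappa> * h (Nx, Nt, Nl) ^ p"
    and nonneg: "\<And>N. 0 \<le> err N" and "p > 0"
    and h: "\<And>Nx Nt Nl. h (Nx, Nt, Nl) = a / real Nx + b / real Nt + d / real Nl"
  shows "convergent_of_order p h err"
proof -
  let ?F = "at_top \<times>\<^sub>F at_top \<times>\<^sub>F at_top :: (nat \<times> nat \<times> nat) filter"
  have lim: "filterlim fst at_top ?F" "filterlim (\<lambda>N. fst (snd N)) at_top ?F"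
      "filterlim (\<lambda>N. snd (snd N)) at_top ?F"
    by (rule filterlim_fst filterlim_compose[OF filterlim_fst filterlim_snd]
        filterlim_compose[OF filterlim_snd filterlim_snd])+
  have h': "h = (\<lambda>N. a / real (fst N) + b / real (fst (snd N)) + d / real (snd (snd N)))"
    using h by (auto simp: fun_eq_iff)
  have "(h \<longlongrightarrow> 0 + 0 + 0) ?F"
    unfolding h' by (intro tendsto_add filterlim_compose[OF lim_const_over_n] lim)
  then have "((\<lambda>N. \<kappa> * h N ^ p) \<longlongrightarrow> \<kappa> * (0 + 0 + 0) ^ p) ?F"
    by (intro tendsto_mult tendsto_power tendsto_const)
  then have lim0: "((\<lambda>N. \<kappa> * h N ^ p) \<longlongrightarrow> 0) ?F" using assms(3) by (simp add: power_0_left)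
  have "\<forall>\<^sub>F N in ?F. 1 \<le> fst N \<and> 1 \<le> fst (snd N) \<and> 1 \<le> snd (snd N)"
    using lim[unfolded filterlim_at_top, rule_format, of 1] by (simp add: eventually_conj_iff)
  then have le: "\<forall>\<^sub>F N in ?F. err N \<le> \<kappa> * h N ^ p"
  proof eventually_elim
    case (elim N)
    then show ?case by (cases N) (simp add: bound)
  qed
  have "(err \<longlongrightarrow> 0) ?F"
    by (rule tendsto_sandwich[OF _ le tendsto_const lim0]) (simp add: nonneg)
  moreover have "err \<in> O[?F](\<lambda>N. h N ^ p)"
  proof (rule bigoI[of _ "\<bar>\<kappa>\<bar>"])
    show "\<forall>\<^sub>F N in ?F. norm (err N) \<le> \<bar>\<kappa>\<bar> * norm (h N ^ p)"
      using le
    proof eventually_elim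
      case (elim N)
      then show ?case
        using nonneg[of N] abs_ge_self[of "\<kappa> * h N ^ p"] by (simp add: abs_mult)
    qed
  qed
  ultimately show ?thesis unfolding convergent_of_order_def by blast
qed

lemma max_grid_error_nonneg: "0 \<le> max_grid_error c u dx dt Nx Nt"
proof -
  have "\<bar>c (real 0 * dx) (real 0 * dt) - u 0 0\<bar> \<le> max_grid_error c u dx dt Nx Nt"
    unfolding max_grid_error_def by (intro Max_ge image_eqI[of _ _ "(0, 0)"]) auto
  then show ?thesis by linarith
qed

lemma max_grid_error_le:
  assumes "\<And>n j. n \<le> Nt \<Longrightarrow> j \<le> Nx \<Longrightarrow> \<bar>c (real j * dx) (real n * dt) - u n j\<bar> \<le> B"
  shows "max_grid_error c u dx dt Nx Nt \<le> B"
  unfolding max_grid_error_def using assms by (subst Max_le_iff) auto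

theorem theorem5p2:
  fixes L T lam0 lam1 \<mu> a\<^sub>1 a\<^sub>2 :: real
    and f c\<^sub>0 I \<epsilon>\<^sub>A \<epsilon>\<^sub>B \<phi> :: "real \<Rightarrow> real"
    and c :: "real \<Rightarrow> real \<Rightarrow> real"
    and R :: "real \<Rightarrow> real \<Rightarrow> real \<Rightarrow> real"
    and u :: "nat \<Rightarrow> nat \<Rightarrow> nat \<Rightarrow> nat \<Rightarrow> nat \<Rightarrow> real"
    and h err :: "nat \<times> nat \<times> nat \<Rightarrow> real"
  assumes "L > 0" and "T > 0" and "lam0 < lam1" and "\<mu> > 0" and "a\<^sub>1 > 0" and "a\<^sub>2 \<ge> 0"
    and "C2_on f {0..L}" and "\<And>x. x \<in> {0..L} \<Longrightarrow> f x \<ge> 0"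
    and "C2_on c\<^sub>0 {0..L}" and "\<And>x. x \<in> {0..L} \<Longrightarrow> c\<^sub>0 x > 0"
    and "C2_on I {lam0..lam1}" and "\<And>l. l \<in> {lam0..lam1} \<Longrightarrow> 0 \<le> I l \<and> I l \<le> 1"
    and "C2_on (rho a\<^sub>1 a\<^sub>2) {0..}" and "\<And>X. X \<ge> 0 \<Longrightarrow> rho a\<^sub>1 a\<^sub>2 X \<ge> 0"
    and "C2_on \<epsilon>\<^sub>A {lam0..lam1}" and "C2_on \<epsilon>\<^sub>B {lam0..lam1}"
    and "\<And>s. s > 0 \<Longrightarrow> \<phi> s > 0" and "(\<lambda>s. \<phi> s - s) \<in> O[at_right 0](\<lambda>s. s\<^sup>2)"
    and "R = (\<lambda>l y s. rho a\<^sub>1 a\<^sub>2 (iota \<mu> I \<epsilon>\<^sub>A \<epsilon>\<^sub>B l y s))"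
    and "photo_solution R f c\<^sub>0 L T lam0 lam1 c"
    and "\<And>Nx Nt Nl. u Nx Nt Nl = pc_scheme R f c\<^sub>0 \<phi> lam0
           (L / real Nx) (T / real Nt) ((lam1 - lam0) / real Nl) Nl"
    and "\<And>Nx Nt Nl. h (Nx, Nt, Nl) = L / real Nx + T / real Nt + (lam1 - lam0) / real Nl"
    and "\<And>Nx Nt Nl. err (Nx, Nt, Nl) =
           max_grid_error c (u Nx Nt Nl) (L / real Nx) (T / real Nt) Nx Nt"
  shows "(\<exists>\<kappa>>0. \<forall>Nx\<ge>1. \<forall>Nt\<ge>1. \<forall>Nl\<ge>1. err (Nx, Nt, Nl) \<le> \<kappa> * (h (Nx, Nt, Nl))\<^sup>2)
         \<and> convergent_of_order 2 h err"
proof -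
  interpret photochemical_problem L T lam0 lam1 \<mu> "rho a\<^sub>1 a\<^sub>2" f c\<^sub>0 I \<epsilon>\<^sub>A \<epsilon>\<^sub>B R c
  proof
    show "0 \<le> I l" if "l \<in> {lam0..lam1}" for l using assms(12)[OF that] by simp
  qed (fact assms)+
  obtain K where K: "K \<ge> 0" "\<forall>n\<ge>1. \<bar>\<phi> (T / real n) - T / real n\<bar> \<le> K * (T / real n)\<^sup>2"
    using quadratic_remainder_on_grid[OF assms(18,2)] by blast
  obtain \<kappa> where \<kappa>: "\<kappa> \<ge> 0" "\<forall>dx dt dl Nx Nt Nl. step_sizes \<phi> K dx dt dl Nl \<longrightarrow> real Nx * dx = L \<longrightarrow>
      real Nt * dt = T \<longrightarrow> (\<forall>n\<le>Nt. \<forall>j\<le>Nx.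
      \<bar>c (real j * dx) (real n * dt) - pc_scheme R f c\<^sub>0 \<phi> lam0 dx dt dl Nl n j\<bar> \<le> \<kappa> * (dx + dt + dl)\<^sup>2)"
    using global_error[OF K(1), of \<phi>] by (elim exE conjE)
  \<comment> \<open>Adding \<open>1\<close> makes the constant positive.\<close>
  have bound: "err (Nx, Nt, Nl) \<le> (\<kappa> + 1) * (h (Nx, Nt, Nl))\<^sup>2" if N: "Nx \<ge> 1" "Nt \<ge> 1" "Nl \<ge> 1" for Nx Nt Nl
  proof -
    have "step_sizes \<phi> K (L / real Nx) (T / real Nt) ((lam1 - lam0) / real Nl) Nl"
      unfolding step_sizes_def using N K(2)[rule_format, OF N(2)] L_pos T_pos lam_less assms(17) by simp
    then have "err (Nx, Nt, Nl) \<le> \<kappa> * (h (Nx, Nt, Nl))\<^sup>2"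
      unfolding assms(21-23) using N by (intro max_grid_error_le \<kappa>(2)[rule_format]) auto
    also have "\<dots> \<le> (\<kappa> + 1) * (h (Nx, Nt, Nl))\<^sup>2" by (intro mult_right_mono) auto
    finally show ?thesis .
  qed
  have nonneg: "0 \<le> err N" for N
    by (cases N) (simp add: assms(23) max_grid_error_nonneg)
  have "convergent_of_order 2 h err"
    by (rule convergent_of_orderI[OF bound nonneg _ assms(22)]) simp_all
  moreover have "\<kappa> + 1 > 0" using \<kappa>(1) by simp
  ultimately show ?thesis using bound by blast
qed

end
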